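(* Let $M\ge 1$, let $f_1,\dots,f_M$ be location-scale families of densities on $\mathbb{R}$, let $f(x;\theta)$, $\theta\in\Theta$, be the corresponding $M$-component mixture, let $\theta_0\in\Theta$, $f_0(x)=f(x;\theta_0)$, and let $x_1,x_2,\dots$ be i.i.d. with density $f(x;\theta_0)$. Assume: (i) there are real constants $v_0,v_1>0$ and $\beta>1$ such that $f_m(x;\mu_m=0,\sigma_m=1)\le\min\{v_0,\,v_1|x|^{-\beta}\}$ for all $x$ and all $m$; (ii) for every compact $\Gamma\subset\Theta$, each $\theta\in\Gamma$ and all sufficiently small $\rho>0$, the function $x\mapsto f(x;\theta,\rho)=\sup_{\operatorname{dist}(\theta',\theta)\le\rho}f(x;\theta')$ is measurable; (iii) for every compact $\Gamma\subset\Theta$ and each $\theta\in\Gamma$, if $\theta^{(j)}\in\Gamma$ and $\lim_{j\to\infty}\theta^{(j)}=\theta$, then $\lim_{j\to\infty}f(x;\theta^{(j)})=f(x;\theta)$ except on a null set of $x$ which does not depend on the sequence $\{\theta^{(j)}\}$; (iv) $\int|\log f(x;\theta_0)|\,f(x;\theta_0)\,dx<\infty$. Suppose moreover that $f_0\in\mathscr{G}_M\setminus\mathscr{G}_{M-1}$. Let $c_0>0$ and $0<d<1$, let $c_n=c_0\exp(-n^d)$ and $\Theta_n=\{\theta\in\Theta\mid\sigma_m\ge c_n,\ m=1,\dots,M\}$, let $\hat\theta_n$ be the maximum likelihood estimator restricted to $\Theta_n$ based on $x_1,\dots,x_n$, and let $\hat f_n(x)=f(x;\hat\theta_n)$. Then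 $\hat f_n$ is strongly consistent, i.e. $$\mathrm{Prob}\left(\lim_{n\to\infty}\|\hat f_n-f_0\|=0\right)=1,$$ where $\|\cdot\|$ is the $L_1$-norm.
   Context: For $m=1,\dots,M$, $f_m(x;\mu_m,\sigma_m)=\frac1{\sigma_m}f_m\left(\frac{x-\mu_m}{\sigma_m};0,1\right)$ is a location-scale family of probability densities on $\mathbb{R}$ with $\mu_m\in\mathbb{R}$, $\sigma_m>0$ (different $m$ may use different families). The parameter is $\theta=(\alpha_1,\mu_1,\sigma_1,\dots,\alpha_M,\mu_M,\sigma_M)$; $\Theta$ is the set of such $\theta$ with $\alpha_m\ge0$, $\sum_{m=1}^M\alpha_m=1$, $\mu_m\in\mathbb{R}$, $\sigma_m\in(0,\infty)$. The mixture density is $f(x;\theta)=\sum_{m=1}^M\alpha_m f_m(x;\mu_m,\sigma_m)$. $\operatorname{dist}$ is Euclidean distance between parameter vectors. For $\mathscr{K}\subset\{1,\dots,M\}$, $\theta_{\mathscr{K}}$ is the subvector of $\theta$ consisting of the components in $\mathscr{K}$; $\bar\Theta_{\mathscr{K}}=\{\theta_{\mathscr{K}}\mid\theta\in\Theta,\ \sum_{m\in\mathscr{K}}\alpha_m\le1\}$; $f_{\mathscr{K}}(x;\theta_{\mathscr{K}})=\sum_{k\in\mathscr{K}}\alpha_kf_k(x;\mu_k,\sigma_k)$; $\mathscr{G}_{\mathscr{K}}=\{f_{\mathscr{K}}(\cdot;\theta_{\mathscr{K}})\mid\theta_{\mathscr{K}}\in\bar\Theta_{\mathscr{K}}\}$;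 and $\mathscr{G}_K=\bigcup_{|\mathscr{K}|\le K}\mathscr{G}_{\mathscr{K}}$ is the set of subprobability densities with no more than $K$ components. The maximum likelihood estimator restricted to $\Theta_n$ is a maximizer $\hat\theta_n$ of $\prod_{i=1}^nf(x_i;\theta)$ over $\theta\in\Theta_n$. *)

theory Defs
  imports "HOL-Probability.Probability"
begin

definition probability_density :: "(real \<Rightarrow> real) \<Rightarrow> bool" where
  "probability_density g \<longleftrightarrow>
     g \<in> borel_measurable borel \<and> (\<forall>x. 0 \<le> g x) \<and> (\<integral>\<^sup>+ x. ennreal (g x) \<partial>lborel) = 1"

text \<open>The argument order of a family is \<open>f x \<mu> \<sigma>\<close>; its values at \<open>\<sigma> \<le> 0\<close> are unconstrained
  and never used.\<close>

definition location_scale_family :: "(real \<Rightarrow> real \<Rightarrow> real \<Rightarrow> real) \<Rightarrow> bool" where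
  "location_scale_family f \<longleftrightarrow>
     (\<forall>\<mu> \<sigma>. \<sigma> > 0 \<longrightarrow> probability_density (\<lambda>x. f x \<mu> \<sigma>)) \<and>
     (\<forall>x \<mu> \<sigma>. \<sigma> > 0 \<longrightarrow> f x \<mu> \<sigma> = 1 / \<sigma> * f ((x - \<mu>) / \<sigma>) 0 1)"

text \<open>The component labels are the elements of a finite type \<open>'m\<close>, so the number of components
  is \<open>M = CARD('m)\<close>. A parameter is a vector of triples \<open>(\<alpha>\<^sub>m, \<mu>\<^sub>m, \<sigma>\<^sub>m)\<close>. The library metric
  on pairs and on vectors is in each case the square root of the sum of the squared distances, hence
  \<open>dist\<close> on \<open>'m param\<close> is the Euclidean distance of the \<open>3 M\<close>-dimensional parameter vectors.\<close>

type_synonym comp = "real \<times> real \<times> real"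
type_synonym 'm param = "comp ^ 'm"
type_synonym 'm families = "'m \<Rightarrow> real \<Rightarrow> real \<Rightarrow> real \<Rightarrow> real"

abbreviation weight :: "comp \<Rightarrow> real" where "weight c \<equiv> fst c"
abbreviation loc :: "comp \<Rightarrow> real" where "loc c \<equiv> fst (snd c)"
abbreviation scale :: "comp \<Rightarrow> real" where "scale c \<equiv> snd (snd c)"

definition Theta :: "('m::finite) param set" where
  "Theta = {\<theta>. (\<forall>m. 0 \<le> weight (\<theta> $ m)) \<and> (\<Sum>m\<in>UNIV. weight (\<theta> $ m)) = 1 \<and>
                (\<forall>m. 0 < scale (\<theta> $ m))}"

definition mixture :: "('m::finite) families \<Rightarrow> real \<Rightarrow> 'm param \<Rightarrow> real" where
  "mixture f x \<theta> = (\<Sum>m\<in>UNIV. weight (\<theta> $ m) * f m x (loc (\<theta> $ m)) (scale (\<theta> $ m)))"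

text \<open>The supremum is over parameters, i.e. over elements of \<open>Theta\<close>. It is taken in the extended
  reals, as the set of values may be unbounded when \<open>\<rho>\<close> is not small.\<close>

definition mixture_sup :: "('m::finite) families \<Rightarrow> real \<Rightarrow> 'm param \<Rightarrow> real \<Rightarrow> ereal" where
  "mixture_sup f x \<theta> \<rho> = (SUP \<theta>'\<in>{\<theta>' \<in> Theta. dist \<theta>' \<theta> \<le> \<rho>}. ereal (mixture f x \<theta>'))"

text \<open>The subvector of \<open>\<theta>\<close> indexed by \<open>K\<close> is a function that is \<open>undefined\<close> outside \<open>K\<close>.\<close>

definition subvector :: "'m set \<Rightarrow> ('m::finite) param \<Rightarrow> 'm \<Rightarrow> comp" where
  "subvector K \<theta> = restrict (\<lambda>m. \<theta> $ m) K"

definition Theta_bar :: "('m::finite) set \<Rightarrow> ('m \<Rightarrow> comp) set" where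
  "Theta_bar K = {subvector K \<theta> |\<theta>. \<theta> \<in> Theta \<and> (\<Sum>m\<in>K. weight (\<theta> $ m)) \<le> 1}"

definition submixture :: "('m::finite) families \<Rightarrow> 'm set \<Rightarrow> real \<Rightarrow> ('m \<Rightarrow> comp) \<Rightarrow> real" where
  "submixture f K x \<eta> = (\<Sum>k\<in>K. weight (\<eta> k) * f k x (loc (\<eta> k)) (scale (\<eta> k)))"

definition G_set :: "('m::finite) families \<Rightarrow> 'm set \<Rightarrow> (real \<Rightarrow> real) set" where
  "G_set f K = {(\<lambda>x. submixture f K x \<eta>) |\<eta>. \<eta> \<in> Theta_bar K}"

definition G_upto :: "('m::finite) families \<Rightarrow> nat \<Rightarrow> (real \<Rightarrow> real) set" where
  "G_upto f k = (\<Union>K\<in>{K. card K \<le> k}. G_set f K)"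

definition Theta_ge :: "real \<Rightarrow> ('m::finite) param set" where
  "Theta_ge c = {\<theta> \<in> Theta. \<forall>m. c \<le> scale (\<theta> $ m)}"

definition likelihood :: "('m::finite) families \<Rightarrow> nat \<Rightarrow> (nat \<Rightarrow> real) \<Rightarrow> 'm param \<Rightarrow> real" where
  "likelihood f n x \<theta> = (\<Prod>i=1..n. mixture f (x i) \<theta>)"

definition is_restricted_mle ::
  "('m::finite) families \<Rightarrow> 'm param set \<Rightarrow> nat \<Rightarrow> (nat \<Rightarrow> real) \<Rightarrow> 'm param \<Rightarrow> bool" where
  "is_restricted_mle f T n x \<theta> \<longleftrightarrow> is_arg_max (likelihood f n x) (\<lambda>\<theta>'. \<theta>' \<in> T) \<theta>"

definition L1_norm :: "(real \<Rightarrow> real) \<Rightarrow> real" where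
  "L1_norm g = (\<integral>x. \<bar>g x\<bar> \<partial>lborel)"

end

theory Submission
  imports Defs "HOL-Real_Asymp.Real_Asymp"
begin

text \<open>
  The maximum likelihood estimator wins against the true density \<open>q\<close> in terms of likelihood, so it
  suffices that, almost surely and for all large \<open>n\<close>, no density of the sieve at \<open>L\<^sub>1\<close>-distance
  at least \<open>e\<close> from \<open>q\<close> reaches the likelihood of \<open>q\<close>.

  For a single density \<open>p\<close> far from \<open>q\<close> this is a Chernoff bound: the expectation of
  \<open>\<Prod>i\<le>n. sqrt (p (X i) / q (X i))\<close> is the \<open>n\<close>-th power of the Hellinger affinity
  \<open>\<integral> sqrt (p * q)\<close>, which is at most \<open>1 - e\<^sup>2 / 8\<close>. The bound survives if \<open>p\<close> is replaced by a function
  \<open>b \<ge> p\<close> that exceeds \<open>p\<close> by little in \<open>L\<^sub>1\<close> (\<open>bracket_affinity_le\<close>), and one \<open>b\<close> takes care of all \<open>p\<close>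
  below it. Hence the Borel--Cantelli lemma applies as soon as the \<open>n\<close>-th sieve is covered by a number
  of such upper brackets that grows more slowly than every exponential; this is
  \<open>sieve_mle_consistent\<close>. The brackets only need to dominate on sets \<open>D n\<close> that
  eventually contain the sample \<open>X 1, \<dots>, X n\<close>. By the tail bound on the components, intervals of polynomial
  length have this property (\<open>AE_sample_in_interval\<close>).

  It remains to cover the mixtures with all scales at least \<open>c n\<close>, and brackets of mixtures are sums of
  brackets of the weighted components (\<open>subexp_bracketed_sum\<close>). Near the parameter \<open>(0, 1)\<close> a component
  has a majorant of integral close to \<open>1\<close>: the supremum of the densities over a shrinking neighbourhood
  decreases to the density itself by continuity in the parameter, and dominated convergence applies
  (\<open>local_majorant\<close>). Translating and dilating this one majorant covers a neighbourhood of every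
  parameter whose size is proportional to the scale, so that a grid of mesh proportional to \<open>c n\<close> covers
  all parameters in a bounded region. Components outside a region of polynomial size are uniformly tiny
  on \<open>D n\<close> and share a single constant bracket. The number of brackets is polynomially bounded in \<open>n\<close> and
  \<open>1 / c n\<close>, hence subexponential, since \<open>1 / c n\<close> is a constant times \<open>exp (n powr d)\<close> with \<open>d < 1\<close>
  (\<open>component_bracketed\<close>).
\<close>

section \<open>Subexponential sequences\<close>

definition subexponential :: "(nat \<Rightarrow> real) \<Rightarrow> bool" where
  "subexponential a \<longleftrightarrow> (\<forall>\<kappa>>0. \<forall>\<^sub>F n in sequentially. a n \<le> exp (\<kappa> * real n))"

lemma subexponential_mono:
  assumes "subexponential b" "\<forall>\<^sub>F n in sequentially. a n \<le> b n"
  shows "subexponential a"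
  unfolding subexponential_def
proof (intro allI impI)
  fix \<kappa> :: real assume "\<kappa> > 0"
  then have "\<forall>\<^sub>F n in sequentially. b n \<le> exp (\<kappa> * real n)"
    using assms(1) by (auto simp: subexponential_def)
  with assms(2) show "\<forall>\<^sub>F n in sequentially. a n \<le> exp (\<kappa> * real n)"
    by eventually_elim linarith
qed

lemma subexponential_const: "subexponential (\<lambda>_. C)"
  unfolding subexponential_def
proof (intro allI impI)
  fix \<kappa> :: real assume "\<kappa> > 0"
  then show "\<forall>\<^sub>F n in sequentially. C \<le> exp (\<kappa> * real n)"
    by real_asymp
qed

lemma subexponential_mult:
  assumes "subexponential a" "subexponential b" "\<And>n. 0 \<le> a n" "\<And>n. 0 \<le> b n"
  shows "subexponential (\<lambda>n. a n * b n)"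
  unfolding subexponential_def
proof (intro allI impI)
  fix \<kappa> :: real assume "\<kappa> > 0"
  then have "\<forall>\<^sub>F n in sequentially. a n \<le> exp (\<kappa> / 2 * real n)"
    "\<forall>\<^sub>F n in sequentially. b n \<le> exp (\<kappa> / 2 * real n)"
    using assms(1,2) unfolding subexponential_def by (meson half_gt_zero)+
  then show "\<forall>\<^sub>F n in sequentially. a n * b n \<le> exp (\<kappa> * real n)"
  proof eventually_elim
    case (elim n)
    then have "a n * b n \<le> exp (\<kappa> / 2 * real n) * exp (\<kappa> / 2 * real n)"
      using assms(3,4) by (intro mult_mono) auto
    then show ?case by (simp flip: exp_add)
  qed
qed

lemma subexponential_add:
  assumes "subexponential a" "subexponential b"
  shows "subexponential (\<lambda>n. a n + b n)"
  unfolding subexponential_def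
proof (intro allI impI)
  fix \<kappa> :: real assume "\<kappa> > 0"
  then have "\<forall>\<^sub>F n in sequentially. a n \<le> exp (\<kappa> / 2 * real n)"
    "\<forall>\<^sub>F n in sequentially. b n \<le> exp (\<kappa> / 2 * real n)"
    using assms(1,2) unfolding subexponential_def by (meson half_gt_zero)+
  moreover have "\<forall>\<^sub>F n in sequentially. 2 * exp (\<kappa> / 2 * real n) \<le> exp (\<kappa> * real n)"
    using \<open>\<kappa> > 0\<close> by real_asymp
  ultimately show "\<forall>\<^sub>F n in sequentially. a n + b n \<le> exp (\<kappa> * real n)"
    by eventually_elim linarith
qed

lemma subexponential_prod:
  assumes "finite I" "\<And>i. i \<in> I \<Longrightarrow> subexponential (a i)" "\<And>i n. i \<in> I \<Longrightarrow> 0 \<le> a i n"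
  shows "subexponential (\<lambda>n. \<Prod>i\<in>I. a i n)"
  using assms
  by (induction I rule: finite_induct)
     (auto intro!: subexponential_const subexponential_mult prod_nonneg)

section \<open>Upper brackets\<close>

text \<open>Domination and small excess are required on \<open>D\<close> only, because the bracket for remote components is a
  small constant cut off outside \<open>D\<close>.\<close>

definition upper_bracket :: "real set \<Rightarrow> real \<Rightarrow> (real \<Rightarrow> real) \<Rightarrow> (real \<Rightarrow> real) \<Rightarrow> bool" where
  "upper_bracket D \<eta> p b \<longleftrightarrow> integrable lborel b \<and> (\<forall>x. 0 \<le> b x) \<and> (\<forall>x\<in>D. p x \<le> b x) \<and>
     (\<integral>x. indicator D x * (b x - p x) \<partial>lborel) \<le> \<eta>"

text \<open>Since the accuracy \<open>\<eta>\<close> is fixed before \<open>n\<close> grows, the covering number may depend on \<open>\<eta>\<close> in any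
  way. A subexponential number of brackets is what a union bound over events of exponentially small
  probability tolerates.\<close>

definition subexp_bracketed :: "(nat \<Rightarrow> real set) \<Rightarrow> (nat \<Rightarrow> (real \<Rightarrow> real) set) \<Rightarrow> bool" where
  "subexp_bracketed D F \<longleftrightarrow> (\<forall>\<eta>>0. \<exists>B. (\<forall>n. finite (B n)) \<and> subexponential (\<lambda>n. real (card (B n))) \<and>
     (\<forall>\<^sub>F n in sequentially. \<forall>p\<in>F n. \<exists>b\<in>B n. upper_bracket (D n) \<eta> p b))"

section \<open>Hellinger affinity of an upper bracket\<close>

lemma sqrt_mult_le_amgm:
  fixes a q t :: real
  assumes "0 \<le> a" "0 \<le> q" "t > 0"
  shows "sqrt (a * q) \<le> a / (2 * t) + t * q / 2"
proof -
  have "sqrt (a / t * (t * q)) \<le> (a / t + t * q) / 2"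
    using assms by (intro arith_geo_mean_sqrt) auto
  then show ?thesis using assms by (simp add: add_divide_distrib)
qed

text \<open>With \<open>u = sqrt p\<close> and \<open>v = sqrt q\<close>, the inequality
  \<open>2 l \<bar>u - v\<bar> (u + v) \<le> (u - v)\<^sup>2 + l\<^sup>2 (u + v)\<^sup>2\<close> is the pointwise form of the Cauchy--Schwarz bound
  of the \<open>L\<^sub>1\<close>-distance by the Hellinger distance; working pointwise allows \<open>p\<close> to be changed on part of
  the line before integrating.\<close>

lemma sqrt_mult_le_density_gap:
  fixes p q l :: real
  assumes "0 \<le> p" "0 \<le> q" "l > 0"
  shows "sqrt (p * q) \<le> (p + q) / 2 - l * \<bar>p - q\<bar> + l\<^sup>2 * (p + q)"
proof -
  have "u * v \<le> (u\<^sup>2 + v\<^sup>2) / 2 - l * \<bar>u\<^sup>2 - v\<^sup>2\<bar> + l\<^sup>2 * (u\<^sup>2 + v\<^sup>2)"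
    if "0 \<le> u" "0 \<le> v" for u v :: real
  proof -
    have "2 * (l * (\<bar>u - v\<bar> * (u + v))) \<le> \<bar>u - v\<bar>\<^sup>2 + l\<^sup>2 * (u + v)\<^sup>2"
      using sum_squares_bound[of "\<bar>u - v\<bar>" "l * (u + v)"] by (simp only: power_mult_distrib mult_ac)
    moreover have "\<bar>u - v\<bar> * (u + v) = \<bar>(u - v) * (u + v)\<bar>"
      using that by (simp add: abs_mult)
    then have "\<bar>u - v\<bar> * (u + v) = \<bar>u\<^sup>2 - v\<^sup>2\<bar>"
      by (simp add: power2_eq_square algebra_simps)
    moreover have "(u + v)\<^sup>2 \<le> 2 * (u\<^sup>2 + v\<^sup>2)"
      using sum_squares_bound[of u v] by (simp add: power2_sum)
    then have "l\<^sup>2 * (u + v)\<^sup>2 \<le> l\<^sup>2 * (2 * (u\<^sup>2 + v\<^sup>2))"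
      by (intro mult_left_mono) auto
    then have "l\<^sup>2 * (u + v)\<^sup>2 \<le> 2 * (l\<^sup>2 * (u\<^sup>2 + v\<^sup>2))"
      by (simp only: mult.left_commute)
    moreover have "\<bar>u - v\<bar>\<^sup>2 = u\<^sup>2 + v\<^sup>2 - 2 * (u * v)"
      by (simp add: power2_diff)
    ultimately have "2 * (l * \<bar>u\<^sup>2 - v\<^sup>2\<bar>) \<le> (u\<^sup>2 + v\<^sup>2 - 2 * (u * v)) + 2 * (l\<^sup>2 * (u\<^sup>2 + v\<^sup>2))"
      by (simp only:)
    moreover have "b \<le> c / 2 - a + d" if "2 * a \<le> (c - 2 * b) + 2 * d" for a b c d :: real
      using that by linarith
    ultimately show ?thesis by blast
  qed
  from this[of "sqrt p" "sqrt q"] show ?thesis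
    using assms by (simp add: real_sqrt_mult)
qed

lemma integrable_indicator_mult:
  fixes h :: "real \<Rightarrow> real"
  assumes "D \<in> sets borel" "integrable lborel h"
  shows "integrable lborel (\<lambda>x. indicator D x * h x)"
  using integrable_mult_indicator[of D lborel h] assms by simp

lemma probability_density_integral:
  assumes "probability_density p"
  shows "integrable lborel p" "(\<integral>x. p x \<partial>lborel) = 1"
proof -
  from assms have [measurable]: "p \<in> borel_measurable borel" and "\<And>x. 0 \<le> p x"
    "(\<integral>\<^sup>+ x. ennreal (p x) \<partial>lborel) = 1"
    by (auto simp: probability_density_def)
  then show "integrable lborel p"
    by (intro integrableI_nonneg) auto
  then show "(\<integral>x. p x \<partial>lborel) = 1"
    using \<open>(\<integral>\<^sup>+ x. ennreal (p x) \<partial>lborel) = 1\<close> \<open>\<And>x. 0 \<le> p x\<close>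
    by (simp add: integral_eq_nn_integral)
qed

text \<open>On \<open>D\<close>, \<open>sqrt (b q) \<le> sqrt (p q) + sqrt ((b - p) q)\<close>. The first term integrates to at most
  \<open>1 - l e + 2 l\<^sup>2\<close>, which is \<open>1 - e\<^sup>2 / 8 = 1 - 2 t\<close> for the optimal \<open>l = e / 4\<close>; the second one
  integrates to at most \<open>t\<close>, because the bracket exceeds \<open>p\<close> by at most \<open>t\<^sup>2\<close> in integral.\<close>

lemma bracket_affinity_le:
  assumes p: "probability_density p" and q: "probability_density q"
    and D [measurable]: "D \<in> sets borel"
    and b: "upper_bracket D (t\<^sup>2) p b"
    and far: "e \<le> L1_norm (\<lambda>x. p x - q x)" and e: "0 < e" and t: "t = e\<^sup>2 / 16"
  shows "(\<integral>\<^sup>+x. ennreal (indicator D x * sqrt (b x * q x)) \<partial>lborel) \<le> ennreal (1 - t)"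
proof -
  \<comment> \<open>the maximizer of \<open>l e - 2 l\<^sup>2\<close>\<close>
  define l where "l = e / 4"
  have l: "l > 0" and tpos: "t > 0" using e unfolding t l_def by auto
  note [simp] = probability_density_integral[OF p] probability_density_integral[OF q]
  have nonneg: "0 \<le> p x" "0 \<le> q x" for x
    using p q by (auto simp: probability_density_def)
  have [measurable]: "p \<in> borel_measurable borel" "q \<in> borel_measurable borel"
    using p q by (auto simp: probability_density_def)
  have bb: "integrable lborel b" "\<And>x. 0 \<le> b x" "\<And>x. x \<in> D \<Longrightarrow> p x \<le> b x"
      "(\<integral>x. indicator D x * (b x - p x) \<partial>lborel) \<le> t\<^sup>2"
    using b by (auto simp: upper_bracket_def)
  have [simp]: "integrable lborel (\<lambda>x. indicator D x * (b x - p x))"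
    using bb by (intro integrable_indicator_mult) auto
  have [simp]: "integrable lborel (\<lambda>x. \<bar>p x - q x\<bar>)" by simp
  define h where "h x = ((p x + q x) / 2 - l * \<bar>p x - q x\<bar> + l\<^sup>2 * (p x + q x)) +
     (indicator D x * (b x - p x) / (2 * t) + t * q x / 2)" for x
  have h_int: "has_bochner_integral lborel h ((1 + 1) / 2 - l * L1_norm (\<lambda>x. p x - q x) + l\<^sup>2 * (1 + 1) +
      ((\<integral>x. indicator D x * (b x - p x) \<partial>lborel) / (2 * t) + t * 1 / 2))"
    unfolding h_def L1_norm_def
    by (intro has_bochner_integral_add has_bochner_integral_diff has_bochner_integral_mult_right
        has_bochner_integral_divide_zero) (auto simp: has_bochner_integral_iff)
  have h_ge: "indicator D x * sqrt (b x * q x) \<le> h x" and h_nonneg: "0 \<le> h x" for x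
  proof -
    have 1: "sqrt (p x * q x) \<le> (p x + q x) / 2 - l * \<bar>p x - q x\<bar> + l\<^sup>2 * (p x + q x)"
      using nonneg l by (intro sqrt_mult_le_density_gap)
    have 2: "0 \<le> sqrt (p x * q x)" using nonneg by simp
    have 3: "0 \<le> t * q x / 2" using nonneg tpos by simp
    have split: "0 + indicator D x * (b x - p x) / (2 * t) \<le> h x"
      unfolding h_def using 1 2 3 by (intro add_mono) linarith+
    show "indicator D x * sqrt (b x * q x) \<le> h x"
    proof (cases "x \<in> D")
      case True
      then have "0 \<le> b x - p x" using bb by simp
      have "sqrt (b x * q x) = sqrt (p x * q x + (b x - p x) * q x)" by (simp add: algebra_simps)
      also have "\<dots> \<le> sqrt (p x * q x) + sqrt ((b x - p x) * q x)"
        using \<open>0 \<le> b x - p x\<close> nonneg by (intro sqrt_add_le_add_sqrt) auto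
      also have "sqrt ((b x - p x) * q x) \<le> (b x - p x) / (2 * t) + t * q x / 2"
        using \<open>0 \<le> b x - p x\<close> nonneg tpos by (intro sqrt_mult_le_amgm)
      finally show ?thesis using True 1 by (simp add: h_def)
    next
      case False
      then show ?thesis using split by simp
    qed
    show "0 \<le> h x"
    proof (cases "x \<in> D")
      case True
      then have "0 \<le> (b x - p x) / (2 * t)" using bb(3) tpos by simp
      then show ?thesis using split True by simp
    next
      case False
      then show ?thesis using split by simp
    qed
  qed
  from h_ge have "(\<integral>\<^sup>+x. ennreal (indicator D x * sqrt (b x * q x)) \<partial>lborel) \<le> (\<integral>\<^sup>+x. ennreal (h x) \<partial>lborel)"
    by (intro nn_integral_mono ennreal_leI)
  also have "\<dots> = ennreal (\<integral>x. h x \<partial>lborel)"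
    using h_int h_nonneg by (intro nn_integral_eq_integral) (auto simp: has_bochner_integral_iff)
  also have "(\<integral>x. h x \<partial>lborel) = 1 - l * L1_norm (\<lambda>x. p x - q x) + 2 * l\<^sup>2 +
      ((\<integral>x. indicator D x * (b x - p x) \<partial>lborel) / (2 * t) + t / 2)"
    using h_int by (simp add: has_bochner_integral_iff)
  also have "\<dots> \<le> 1 - l * e + 2 * l\<^sup>2 + (t\<^sup>2 / (2 * t) + t / 2)"
    using far bb(4) l tpos by (intro add_mono diff_mono mult_left_mono divide_right_mono) auto
  also have "\<dots> = 1 - t"
    using tpos by (simp add: l_def t power2_eq_square field_simps)
  finally show ?thesis by (simp add: ennreal_leI)
qed


section \<open>Consistency of maximum likelihood on a bracketed sieve\<close>

text \<open>By independence and Markov's inequality, a fixed \<open>b\<close> violates the bound with probability at most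
  \<open>exp (- t n)\<close>. The number of functions costs at most a factor \<open>exp (t n / 2)\<close>, so the
  probabilities are summable.\<close>

lemma likelihood_ratio_union_bound:
  fixes X :: "nat \<Rightarrow> 'w \<Rightarrow> real"
  assumes P: "prob_space P"
    and indep: "prob_space.indep_vars P (\<lambda>_. borel) X {1..}"
    and distr: "\<And>i. i \<ge> 1 \<Longrightarrow> distributed P lborel (X i) (\<lambda>x. ennreal (q x))"
    and q: "probability_density q"
    and D [measurable]: "\<And>n. D n \<in> sets borel"
    and fin: "\<And>n. finite (B n)" and card: "subexponential (\<lambda>n. real (card (B n)))"
    and t: "0 < t"
    and meas: "\<And>n b. b \<in> B n \<Longrightarrow> b \<in> borel_measurable borel"
    and nonneg: "\<And>n b x. b \<in> B n \<Longrightarrow> 0 \<le> b x"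
    and aff: "\<And>n b. b \<in> B n \<Longrightarrow>
      (\<integral>\<^sup>+x. ennreal (indicator (D n) x * sqrt (b x * q x)) \<partial>lborel) \<le> ennreal (exp (- t))"
  shows "AE \<omega> in P. \<forall>\<^sub>F n in sequentially. \<forall>b\<in>B n.
    (\<Prod>i=1..n. indicator (D n) (X i \<omega>) * sqrt (b (X i \<omega>) / q (X i \<omega>))) < 1"
proof -
  interpret prob_space P by (rule P)
  have [measurable]: "q \<in> borel_measurable borel" and q0: "\<And>x. 0 \<le> q x"
    using q by (auto simp: probability_density_def)
  have X [measurable]: "X i \<in> borel_measurable P" if "i \<ge> 1" for i
    using distributed_measurable[OF distr[OF that]] by simp
  define \<psi> where "\<psi> n b x = indicator (D n) x * sqrt (b x / q x)" for n :: nat and b x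
  have \<psi>0: "0 \<le> \<psi> n b x" if "b \<in> B n" for n b x
    using nonneg[OF that] q0 by (simp add: \<psi>_def)
  have \<psi>_meas: "\<psi> n b \<in> borel_measurable borel" if "b \<in> B n" for n b
    using meas[OF that] unfolding \<psi>_def by measurable
  define E where "E n b = {\<omega> \<in> space P. 1 \<le> (\<Prod>i=1..n. ennreal (\<psi> n b (X i \<omega>)))}" for n b
  have E_meas [measurable]: "E n b \<in> sets P" if "b \<in> B n" for n b
  proof -
    note [measurable] = \<psi>_meas[OF that]
    show ?thesis unfolding E_def by measurable
  qed
  have E_prob: "measure P (E n b) \<le> exp (- t * real n)" if b: "b \<in> B n" for n b
  proof -
    note [measurable] = \<psi>_meas[OF b]
    have one: "(\<integral>\<^sup>+\<omega>. ennreal (\<psi> n b (X i \<omega>)) \<partial>P) \<le> ennreal (exp (- t))" if "i \<ge> 1" for i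
    proof -
      have "(\<integral>\<^sup>+\<omega>. ennreal (\<psi> n b (X i \<omega>)) \<partial>P) = (\<integral>\<^sup>+x. ennreal (q x) * ennreal (\<psi> n b x) \<partial>lborel)"
        by (subst distributed_nn_integral[OF distr[OF that]]) auto
      also have "\<dots> = (\<integral>\<^sup>+x. ennreal (indicator (D n) x * sqrt (b x * q x)) \<partial>lborel)"
      proof (intro nn_integral_cong)
        fix x
        have "q x * sqrt (b x / q x) = sqrt (b x * q x)"
        proof (cases "q x = 0")
          case False
          then have "q x * sqrt (b x / q x) = sqrt (q x) * sqrt (q x) * (sqrt (b x) / sqrt (q x))"
            using q0[of x] by (simp add: real_sqrt_divide)
          also have "\<dots> = sqrt (b x) * sqrt (q x)"
            using False q0[of x] by (simp only: times_divide_eq_right mult.assoc) simp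
          finally show ?thesis by (simp add: real_sqrt_mult)
        qed simp
        then show "ennreal (q x) * ennreal (\<psi> n b x) = ennreal (indicator (D n) x * sqrt (b x * q x))"
          using \<psi>0[OF b, of x] q0[of x] by (simp add: ennreal_mult'[symmetric] \<psi>_def mult.left_commute[of "q x"])
      qed
      also have "\<dots> \<le> ennreal (exp (- t))" by (rule aff[OF b])
      finally show ?thesis .
    qed
    have "emeasure P (E n b) \<le> 1 * (\<integral>\<^sup>+\<omega>. (\<Prod>i=1..n. ennreal (\<psi> n b (X i \<omega>))) * indicator (space P) \<omega> \<partial>P)"
      using nn_integral_Markov_inequality[of "\<lambda>\<omega>. \<Prod>i=1..n. ennreal (\<psi> n b (X i \<omega>))" "space P" P 1]
      by (simp add: E_def)
    also have "\<dots> = (\<integral>\<^sup>+\<omega>. (\<Prod>i=1..n. ennreal (\<psi> n b (X i \<omega>))) \<partial>P)"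
      by (simp cong: nn_integral_cong)
    also have "\<dots> = (\<Prod>i=1..n. \<integral>\<^sup>+\<omega>. ennreal (\<psi> n b (X i \<omega>)) \<partial>P)"
      by (intro indep_vars_nn_integral indep_vars_compose2[OF indep_vars_subset[OF indep]]) auto
    also have "\<dots> \<le> (\<Prod>i=1..n. ennreal (exp (- t)))"
      using one by (intro prod_mono_ennreal) auto
    also have "\<dots> = ennreal (exp (- t * real n))"
      by (simp add: ennreal_power exp_of_nat_mult[symmetric] mult.commute)
    finally show ?thesis
      by (simp add: emeasure_eq_measure)
  qed
  have "AE \<omega> in P. \<forall>\<^sub>F n in sequentially. \<omega> \<in> space P - (\<Union>b\<in>B n. E n b)"
  proof (rule borel_cantelli_AE1)
    show "(\<Union>b\<in>B n. E n b) \<in> sets P" for n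
      using fin by (intro sets.finite_UN) auto
    show "emeasure P (\<Union>b\<in>B n. E n b) < \<infinity>" for n
      by (simp add: less_top[symmetric])
    have card_le: "\<forall>\<^sub>F n in sequentially. real (card (B n)) \<le> exp (t / 2 * real n)"
      using card t unfolding subexponential_def by (meson half_gt_zero)
    have "\<forall>\<^sub>F n in sequentially. norm (measure P (\<Union>b\<in>B n. E n b)) \<le> exp (- (t / 2)) ^ n"
      using card_le
    proof eventually_elim
      case (elim n)
      have "measure P (\<Union>b\<in>B n. E n b) \<le> (\<Sum>b\<in>B n. measure P (E n b))"
        using fin by (intro finite_measure_subadditive_finite) auto
      also have "\<dots> \<le> (\<Sum>b\<in>B n. exp (- t * real n))"
        by (intro sum_mono E_prob)
      also have "\<dots> = real (card (B n)) * exp (- t * real n)" by simp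
      also have "\<dots> \<le> exp (t / 2 * real n) * exp (- t * real n)"
        using elim by (intro mult_right_mono) auto
      also have "\<dots> = exp (- (t / 2)) ^ n"
        by (simp add: exp_of_nat_mult[symmetric] exp_add[symmetric] field_simps)
      finally show ?case by simp
    qed
    then show "summable (\<lambda>n. measure P (\<Union>b\<in>B n. E n b))"
      using t by (elim summable_comparison_test_ev) (auto intro!: summable_geometric)
  qed
  then show ?thesis
  proof (rule AE_mp, intro AE_I2 impI)
    fix \<omega> assume "\<omega> \<in> space P" and "\<forall>\<^sub>F n in sequentially. \<omega> \<in> space P - (\<Union>b\<in>B n. E n b)"
    from this(2) show "\<forall>\<^sub>F n in sequentially. \<forall>b\<in>B n.
        (\<Prod>i=1..n. indicator (D n) (X i \<omega>) * sqrt (b (X i \<omega>) / q (X i \<omega>))) < 1"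
    proof eventually_elim
      case (elim n)
      show ?case
      proof
        fix b assume b: "b \<in> B n"
        then have "\<not> 1 \<le> (\<Prod>i=1..n. ennreal (\<psi> n b (X i \<omega>)))"
          using elim by (auto simp: E_def)
        then have "\<not> ennreal 1 \<le> ennreal (\<Prod>i=1..n. \<psi> n b (X i \<omega>))"
          using \<psi>0[OF b] by (simp add: prod_ennreal)
        then show "(\<Prod>i=1..n. indicator (D n) (X i \<omega>) * sqrt (b (X i \<omega>) / q (X i \<omega>))) < 1"
          using ennreal_leI[of 1] unfolding \<psi>_def by (meson not_le)
      qed
    qed
  qed
qed

lemma sqrt_prod_atLeastAtMost: "sqrt (\<Prod>i=1..n. g i) = (\<Prod>i=1..n. sqrt (g i))"
  for g :: "nat \<Rightarrow> real"
  by (induction n) (simp_all add: real_sqrt_mult)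

text \<open>The exceptional null set must not depend on the estimator, which need not be measurable: the
  statement quantifies over all competing sequences inside the almost sure event.\<close>

lemma sieve_mle_consistent:
  fixes X :: "nat \<Rightarrow> 'w \<Rightarrow> real"
  assumes P: "prob_space P"
    and indep: "prob_space.indep_vars P (\<lambda>_. borel) X {1..}"
    and distr: "\<And>i. i \<ge> 1 \<Longrightarrow> distributed P lborel (X i) (\<lambda>x. ennreal (q x))"
    and q: "probability_density q"
    and D [measurable]: "\<And>n. D n \<in> sets borel"
    and inD: "AE \<omega> in P. \<forall>\<^sub>F n in sequentially. \<forall>i\<in>{1..n}. X i \<omega> \<in> D n"
    and F: "\<And>n p. p \<in> F n \<Longrightarrow> probability_density p"
    and br: "subexp_bracketed D F"
  shows "AE \<omega> in P. \<forall>p. (\<forall>\<^sub>F n in sequentially. p n \<in> F n \<and>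
       (\<Prod>i=1..n. q (X i \<omega>)) \<le> (\<Prod>i=1..n. p n (X i \<omega>))) \<longrightarrow>
     (\<lambda>n. L1_norm (\<lambda>x. p n x - q x)) \<longlonglongrightarrow> 0"
proof -
  interpret prob_space P by (rule P)
  have [measurable]: "q \<in> borel_measurable borel" and q0: "\<And>x. 0 \<le> q x"
    using q by (auto simp: probability_density_def)
  have pos: "AE \<omega> in P. \<forall>i\<in>{1..}. 0 < q (X i \<omega>)"
  proof (subst AE_ball_countable)
    show "\<forall>i\<in>{1..}. AE \<omega> in P. 0 < q (X i \<omega>)"
    proof
      fix i :: nat assume "i \<in> {1..}"
      then have "distributed P lborel (X i) (\<lambda>x. ennreal (q x))" using distr by simp
      then show "AE \<omega> in P. 0 < q (X i \<omega>)"
        by (subst distributed_AE2) auto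
    qed
  qed auto
  have excl: "AE \<omega> in P. \<forall>\<^sub>F n in sequentially. \<forall>p\<in>F n. e \<le> L1_norm (\<lambda>x. p x - q x) \<longrightarrow>
      (\<Prod>i=1..n. p (X i \<omega>)) < (\<Prod>i=1..n. q (X i \<omega>))" if e: "e > 0" for e
  proof -
    define t where "t = e\<^sup>2 / 16"
    have t: "t > 0" "t\<^sup>2 > 0" using e by (auto simp: t_def)
    obtain B where fin: "\<And>n. finite (B n)" and card: "subexponential (\<lambda>n. real (card (B n)))"
      and cover: "\<forall>\<^sub>F n in sequentially. \<forall>p\<in>F n. \<exists>b\<in>B n. upper_bracket (D n) (t\<^sup>2) p b"
      using br[unfolded subexp_bracketed_def, rule_format, OF t(2)] by blast
    \<comment> \<open>the brackets of densities far from \<open>q\<close> are among those whose affinity with \<open>q\<close> is small\<close>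
    define B' where "B' n = {b \<in> B n. b \<in> borel_measurable borel \<and> (\<forall>x. 0 \<le> b x) \<and>
      (\<integral>\<^sup>+x. ennreal (indicator (D n) x * sqrt (b x * q x)) \<partial>lborel) \<le> ennreal (exp (- t))}" for n
    have sub: "B' n \<subseteq> B n" for n by (auto simp: B'_def)
    have "subexponential (\<lambda>n. real (card (B' n)))"
      using sub fin by (intro subexponential_mono[OF card] always_eventually allI of_nat_mono card_mono)
    then have "AE \<omega> in P. \<forall>\<^sub>F n in sequentially. \<forall>b\<in>B' n.
        (\<Prod>i=1..n. indicator (D n) (X i \<omega>) * sqrt (b (X i \<omega>) / q (X i \<omega>))) < 1"
      using t finite_subset[OF sub fin]
      by (intro likelihood_ratio_union_bound[OF P indep distr q D]) (auto simp: B'_def)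
    with inD pos show ?thesis
    proof eventually_elim
      fix \<omega> assume pos: "\<forall>i\<in>{1..}. 0 < q (X i \<omega>)"
      assume "\<forall>\<^sub>F n in sequentially. \<forall>i\<in>{1..n}. X i \<omega> \<in> D n"
        and "\<forall>\<^sub>F n in sequentially. \<forall>b\<in>B' n.
           (\<Prod>i=1..n. indicator (D n) (X i \<omega>) * sqrt (b (X i \<omega>) / q (X i \<omega>))) < 1"
      then show "\<forall>\<^sub>F n in sequentially. \<forall>p\<in>F n. e \<le> L1_norm (\<lambda>x. p x - q x) \<longrightarrow>
          (\<Prod>i=1..n. p (X i \<omega>)) < (\<Prod>i=1..n. q (X i \<omega>))"
        using cover
      proof eventually_elim
        case (elim n)
        show ?case
        proof (intro ballI impI)
          fix p assume p: "p \<in> F n" and far: "e \<le> L1_norm (\<lambda>x. p x - q x)"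
          have p0: "0 \<le> p x" for x using F[OF p] by (simp add: probability_density_def)
          obtain b where b: "b \<in> B n" and ub: "upper_bracket (D n) (t\<^sup>2) p b"
            using elim p by blast
          have "(\<integral>\<^sup>+x. ennreal (indicator (D n) x * sqrt (b x * q x)) \<partial>lborel) \<le> ennreal (1 - t)"
            by (rule bracket_affinity_le[OF F[OF p] q D ub far e t_def])
          also have "\<dots> \<le> ennreal (exp (- t))"
            using exp_ge_add_one_self[of "- t"] by (intro ennreal_leI) simp
          finally have "b \<in> B' n" using b ub by (auto simp: B'_def upper_bracket_def)
          with elim have lt: "(\<Prod>i=1..n. indicator (D n) (X i \<omega>) * sqrt (b (X i \<omega>) / q (X i \<omega>))) < 1"
            by blast
          have "sqrt (\<Prod>i=1..n. p (X i \<omega>) / q (X i \<omega>)) = (\<Prod>i=1..n. sqrt (p (X i \<omega>) / q (X i \<omega>)))"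
            by (rule sqrt_prod_atLeastAtMost)
          also have "\<dots> \<le> (\<Prod>i=1..n. indicator (D n) (X i \<omega>) * sqrt (b (X i \<omega>) / q (X i \<omega>)))"
          proof (intro prod_mono conjI)
            fix i assume i: "i \<in> {1..n}"
            then have "X i \<omega> \<in> D n" "0 < q (X i \<omega>)" using elim pos by auto
            moreover from this have "p (X i \<omega>) \<le> b (X i \<omega>)" using ub by (auto simp: upper_bracket_def)
            ultimately show "sqrt (p (X i \<omega>) / q (X i \<omega>)) \<le>
                indicator (D n) (X i \<omega>) * sqrt (b (X i \<omega>) / q (X i \<omega>))"
              by (simp add: divide_right_mono)
            show "0 \<le> sqrt (p (X i \<omega>) / q (X i \<omega>))" using p0 q0 by simp
          qed
          finally have "sqrt (\<Prod>i=1..n. p (X i \<omega>) / q (X i \<omega>)) < 1" using lt by linarith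
          then have "(\<Prod>i=1..n. p (X i \<omega>)) / (\<Prod>i=1..n. q (X i \<omega>)) < 1"
            by (simp add: prod_dividef)
          moreover have "0 < (\<Prod>i=1..n. q (X i \<omega>))" using pos by (intro prod_pos) auto
          ultimately show "(\<Prod>i=1..n. p (X i \<omega>)) < (\<Prod>i=1..n. q (X i \<omega>))"
            by (simp add: divide_less_eq)
        qed
      qed
    qed
  qed
  have "AE \<omega> in P. \<forall>k::nat. \<forall>\<^sub>F n in sequentially. \<forall>p\<in>F n. inverse (real (Suc k)) \<le> L1_norm (\<lambda>x. p x - q x) \<longrightarrow>
      (\<Prod>i=1..n. p (X i \<omega>)) < (\<Prod>i=1..n. q (X i \<omega>))"
    unfolding AE_all_countable by (intro allI excl) auto
  then show ?thesis
  proof eventually_elim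
    case (elim \<omega>)
    show ?case
    proof (intro allI impI)
      fix p assume mle: "\<forall>\<^sub>F n in sequentially. p n \<in> F n \<and>
         (\<Prod>i=1..n. q (X i \<omega>)) \<le> (\<Prod>i=1..n. p n (X i \<omega>))"
      show "(\<lambda>n. L1_norm (\<lambda>x. p n x - q x)) \<longlonglongrightarrow> 0"
      proof (rule tendstoI)
        fix e :: real assume "e > 0"
        then obtain k where k: "inverse (real (Suc k)) < e" using reals_Archimedean by blast
        have "\<forall>\<^sub>F n in sequentially. \<forall>p\<in>F n. inverse (real (Suc k)) \<le> L1_norm (\<lambda>x. p x - q x) \<longrightarrow>
            (\<Prod>i=1..n. p (X i \<omega>)) < (\<Prod>i=1..n. q (X i \<omega>))"
          using elim by blast
        with mle show "\<forall>\<^sub>F n in sequentially. dist (L1_norm (\<lambda>x. p n x - q x)) 0 < e"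
        proof eventually_elim
          case (elim n)
          then have "L1_norm (\<lambda>x. p n x - q x) < inverse (real (Suc k))"
            by (meson not_le)
          moreover have "0 \<le> L1_norm (\<lambda>x. p n x - q x)" by (simp add: L1_norm_def)
          ultimately show ?case using k by simp
        qed
      qed
    qed
  qed
qed

section \<open>Bounds for location-scale families\<close>

lemma location_scale_family_nonneg:
  assumes "location_scale_family f" "\<sigma> > 0"
  shows "0 \<le> f x \<mu> \<sigma>"
  using assms unfolding location_scale_family_def probability_density_def by blast

lemma location_scale_family_eq:
  assumes "location_scale_family f" "\<sigma> > 0"
  shows "f x \<mu> \<sigma> = 1 / \<sigma> * f ((x - \<mu>) / \<sigma>) 0 1"
  using assms unfolding location_scale_family_def by blast

text \<open>In the coordinate \<open>(x - a) / s\<close> the parameter \<open>(\<mu>, \<sigma>)\<close> becomes \<open>((\<mu> - a) / s, \<sigma> / s)\<close>, which is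
  close to \<open>(0, 1)\<close> when \<open>(\<mu>, \<sigma>)\<close> is close to \<open>(a, s)\<close> relative to \<open>s\<close>.\<close>

lemma location_scale_family_rescale:
  assumes "location_scale_family f" "\<sigma> > 0" "s > 0"
  shows "f x \<mu> \<sigma> = 1 / s * f ((x - a) / s) ((\<mu> - a) / s) (\<sigma> / s)"
proof -
  have "f ((x - a) / s) ((\<mu> - a) / s) (\<sigma> / s) =
      1 / (\<sigma> / s) * f (((x - a) / s - (\<mu> - a) / s) / (\<sigma> / s)) 0 1"
    using assms by (intro location_scale_family_eq) auto
  also have "((x - a) / s - (\<mu> - a) / s) / (\<sigma> / s) = (x - \<mu>) / \<sigma>"
    using assms by (simp flip: diff_divide_distrib)
  finally show ?thesis
    using assms by (simp add: location_scale_family_eq[of f \<sigma> x \<mu>])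
qed

lemma location_scale_family_le_const:
  assumes "location_scale_family f" "\<sigma> > 0" "\<And>x. f x 0 1 \<le> v0"
  shows "f x \<mu> \<sigma> \<le> v0 / \<sigma>"
  using assms(2,3) by (simp add: location_scale_family_eq[OF assms(1,2)] divide_right_mono)

lemma location_scale_family_le_tail:
  assumes "location_scale_family f" "\<sigma> > 0" "x \<noteq> \<mu>"
    and "\<And>x. x \<noteq> 0 \<Longrightarrow> f x 0 1 \<le> v1 * \<bar>x\<bar> powr (- \<beta>)"
  shows "f x \<mu> \<sigma> \<le> v1 * \<sigma> powr (\<beta> - 1) * \<bar>x - \<mu>\<bar> powr (- \<beta>)"
proof -
  have "f x \<mu> \<sigma> \<le> 1 / \<sigma> * (v1 * \<bar>(x - \<mu>) / \<sigma>\<bar> powr (- \<beta>))"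
    unfolding location_scale_family_eq[OF assms(1,2), of x]
    using assms(2,3) by (intro mult_left_mono assms(4)) auto
  also have "\<bar>(x - \<mu>) / \<sigma>\<bar> powr (- \<beta>) = \<bar>x - \<mu>\<bar> powr (- \<beta>) * \<sigma> powr \<beta>"
    using assms(2) by (simp add: abs_divide powr_divide powr_minus field_simps)
  also have "1 / \<sigma> * (v1 * (\<bar>x - \<mu>\<bar> powr (- \<beta>) * \<sigma> powr \<beta>)) =
      v1 * (\<sigma> powr \<beta> / \<sigma> powr 1) * \<bar>x - \<mu>\<bar> powr (- \<beta>)"
    using assms(2) by (simp add: field_simps)
  also have "\<sigma> powr \<beta> / \<sigma> powr 1 = \<sigma> powr (\<beta> - 1)"
    by (rule powr_diff[symmetric])
  finally show ?thesis .
qed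

lemma nn_integral_powr_tail:
  fixes \<beta> R :: real
  assumes "\<beta> > 1" "R > 0"
  shows "(\<integral>\<^sup>+x. ennreal (indicator {x. R < \<bar>x\<bar>} x * \<bar>x\<bar> powr (- \<beta>)) \<partial>lborel)
    \<le> ennreal (2 * R powr (1 - \<beta>) / (\<beta> - 1))"
proof -
  define g :: "real \<Rightarrow> real" where "g x = (if x \<in> {R..} then x powr (- \<beta>) else 0)" for x
  have [measurable]: "g \<in> borel_measurable borel" unfolding g_def by measurable
  have g: "(\<integral>\<^sup>+x. ennreal (g x) \<partial>lborel) = ennreal (R powr (1 - \<beta>) / (\<beta> - 1))"
  proof (rule nn_integral_has_integral_lborel)
    have "- (R powr (- \<beta> + 1)) / (- \<beta> + 1) = R powr (1 - \<beta>) / (\<beta> - 1)"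
      using assms by (simp add: divide_simps) (simp add: algebra_simps)
    then show "(g has_integral R powr (1 - \<beta>) / (\<beta> - 1)) UNIV"
      using has_integral_powr_to_inf[of "- \<beta>" R] assms
      unfolding g_def has_integral_restrict_UNIV by simp
  qed (auto simp: g_def)
  have "(\<integral>\<^sup>+x. ennreal (g (- x)) \<partial>lborel) = (\<integral>\<^sup>+x. ennreal (g x) \<partial>lborel)"
    using nn_integral_real_affine[of "\<lambda>x. ennreal (g x)" "- 1" 0] by simp
  moreover have "(\<integral>\<^sup>+x. ennreal (indicator {x. R < \<bar>x\<bar>} x * \<bar>x\<bar> powr (- \<beta>)) \<partial>lborel) \<le>
      (\<integral>\<^sup>+x. ennreal (g x) + ennreal (g (- x)) \<partial>lborel)"
  proof (intro nn_integral_mono)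
    fix x
    have "indicator {x. R < \<bar>x\<bar>} x * \<bar>x\<bar> powr (- \<beta>) \<le> g x + g (- x)"
      using assms by (auto simp: g_def indicator_def)
    then show "ennreal (indicator {x. R < \<bar>x\<bar>} x * \<bar>x\<bar> powr (- \<beta>)) \<le> ennreal (g x) + ennreal (g (- x))"
      by (simp add: g_def flip: ennreal_plus)
  qed
  ultimately have "(\<integral>\<^sup>+x. ennreal (indicator {x. R < \<bar>x\<bar>} x * \<bar>x\<bar> powr (- \<beta>)) \<partial>lborel) \<le>
      ennreal (R powr (1 - \<beta>) / (\<beta> - 1)) + ennreal (R powr (1 - \<beta>) / (\<beta> - 1))"
    by (simp add: nn_integral_add g)
  then show ?thesis using assms by (simp flip: ennreal_plus)
qed

text \<open>An integrable function that dominates all members of a family with \<open>\<bar>\<mu>\<bar> \<le> 1 / 2\<close> and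
  \<open>1 / 2 \<le> \<sigma> \<le> 2\<close>.\<close>

definition envelope :: "real \<Rightarrow> real \<Rightarrow> real \<Rightarrow> real \<Rightarrow> real" where
  "envelope v0 v1 \<beta> x =
    (if \<bar>x\<bar> \<le> 1 then 2 * v0 else v1 * 2 powr (2 * \<beta> - 1) * \<bar>x\<bar> powr (- \<beta>))"

lemma integrable_envelope:
  assumes "v0 > 0" "v1 > 0" "\<beta> > 1"
  shows "integrable lborel (envelope v0 v1 \<beta>)"
proof -
  have "integrable lborel (\<lambda>x::real. indicator {x. 1 < \<bar>x\<bar>} x * \<bar>x\<bar> powr (- \<beta>))"
    using nn_integral_powr_tail[of \<beta> 1] assms
    by (intro integrableI_nonneg) (auto simp: ennreal_less_top le_less_trans)
  then have "integrable lborel (\<lambda>x. 2 * v0 * indicator {-1..1} x +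
      v1 * 2 powr (2 * \<beta> - 1) * (indicator {x. 1 < \<bar>x\<bar>} x * \<bar>x\<bar> powr (- \<beta>)))"
    by (intro Bochner_Integration.integrable_add integrable_mult_right) auto
  also have "(\<lambda>x. 2 * v0 * indicator {-1..1} x +
      v1 * 2 powr (2 * \<beta> - 1) * (indicator {x. 1 < \<bar>x\<bar>} x * \<bar>x\<bar> powr (- \<beta>))) = envelope v0 v1 \<beta>"
    by (auto simp: fun_eq_iff envelope_def indicator_def)
  finally show ?thesis .
qed

lemma location_scale_family_le_envelope:
  assumes f: "location_scale_family f" and c: "v0 > 0" "v1 > 0" "\<beta> > 1"
    and v0: "\<And>x. f x 0 1 \<le> v0"
    and v1: "\<And>x. x \<noteq> 0 \<Longrightarrow> f x 0 1 \<le> v1 * \<bar>x\<bar> powr (- \<beta>)"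
    and \<mu>: "\<bar>\<mu>\<bar> \<le> 1 / 2" and \<sigma>: "1 / 2 \<le> \<sigma>" "\<sigma> \<le> 2"
  shows "f x \<mu> \<sigma> \<le> envelope v0 v1 \<beta> x"
proof (cases "\<bar>x\<bar> \<le> 1")
  case True
  have "f x \<mu> \<sigma> \<le> v0 / \<sigma>" using f v0 \<sigma> by (intro location_scale_family_le_const) auto
  also have "\<dots> \<le> v0 / (1 / 2)" using c \<sigma> by (intro divide_left_mono) auto
  finally show ?thesis using True by (simp add: envelope_def)
next
  case False
  have far: "\<bar>x\<bar> / 2 \<le> \<bar>x - \<mu>\<bar>" using \<mu> False by arith
  have "f x \<mu> \<sigma> \<le> v1 * \<sigma> powr (\<beta> - 1) * \<bar>x - \<mu>\<bar> powr (- \<beta>)"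
    using f v1 \<sigma> far False by (intro location_scale_family_le_tail) auto
  also have "\<dots> \<le> v1 * 2 powr (\<beta> - 1) * (\<bar>x\<bar> / 2) powr (- \<beta>)"
    using c \<sigma> far False by (intro mult_mono powr_mono2 powr_mono2') auto
  also have "(\<bar>x\<bar> / 2) powr (- \<beta>) = 2 powr \<beta> * \<bar>x\<bar> powr (- \<beta>)"
    by (simp add: powr_divide powr_minus field_simps)
  also have "v1 * 2 powr (\<beta> - 1) * (2 powr \<beta> * \<bar>x\<bar> powr (- \<beta>)) = v1 * 2 powr (2 * \<beta> - 1) * \<bar>x\<bar> powr (- \<beta>)"
    by (simp flip: powr_add)
  finally show ?thesis using False by (simp add: envelope_def)
qed

section \<open>A majorant of a family near the standard parameter\<close>

text \<open>\<open>Theta\<close> is not closed, but only because scales may approach \<open>0\<close>; a radius below all scales of the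
  centre rules this out.\<close>

lemma compact_Theta_cball:
  fixes \<theta> :: "('m::finite) param"
  assumes "\<And>m. r < scale (\<theta> $ m)"
  shows "compact {\<theta>' \<in> Theta. dist \<theta>' \<theta> \<le> r}"
proof -
  have near: "scale (\<theta> $ m) - r \<le> scale (\<theta>' $ m)" if "dist \<theta>' \<theta> \<le> r" for \<theta>' :: "'m param" and m
  proof -
    have "dist (scale (\<theta>' $ m)) (scale (\<theta> $ m)) \<le> dist \<theta>' \<theta>"
      by (meson dist_snd_le dist_vec_nth_le order_trans)
    then show ?thesis using that by (simp add: dist_real_def)
  qed
  have "{\<theta>' \<in> Theta. dist \<theta>' \<theta> \<le> r} = cball \<theta> r \<inter> {\<theta>'. (\<forall>m. 0 \<le> weight (\<theta>' $ m)) \<and>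
      (\<Sum>m\<in>UNIV. weight (\<theta>' $ m)) = 1 \<and> (\<forall>m. scale (\<theta> $ m) - r \<le> scale (\<theta>' $ m))}"
    (is "_ = _ \<inter> ?C")
    using near assms
    by (auto simp: Theta_def dist_commute) (metis diff_gt_0_iff_gt less_le_trans)
  moreover have "closed ?C"
    by (intro closed_Collect_conj closed_Collect_all closed_Collect_le closed_Collect_eq continuous_intros)
  ultimately show ?thesis by (simp add: compact_Int_closed)
qed

text \<open>A Lebesgue measurable function agrees with a Borel function off a Borel null set. There the Borel
  function is replaced by \<open>H\<close>, so that it majorizes everywhere and not just almost everywhere: a
  pointwise majorant can be rescaled and evaluated at the sample without tracking null sets.\<close>

lemma ex_borel_majorant:
  fixes v H :: "real \<Rightarrow> real"
  assumes v: "integrable lebesgue v" and H: "integrable lborel H" and vH: "\<And>x. v x \<le> H x"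
  shows "\<exists>g. integrable lborel g \<and> (\<forall>x. v x \<le> g x) \<and> (\<integral>x. g x \<partial>lborel) = (\<integral>x. v x \<partial>lebesgue)"
proof -
  obtain g' where g' [measurable]: "g' \<in> borel_measurable lborel" and eq: "AE x in lborel. v x = g' x"
    using completion_ex_borel_measurable_real[of v lborel] v by auto
  obtain N where N: "N \<in> null_sets lborel" "{x. v x \<noteq> g' x} \<subseteq> N"
    using eq unfolding eventually_ae_filter by auto
  have [measurable]: "N \<in> sets borel" using N(1) by auto
  have [measurable]: "H \<in> borel_measurable borel" using H by auto
  define g where "g x = (if x \<in> N then H x else g' x)" for x
  have [measurable]: "g \<in> borel_measurable borel" unfolding g_def by measurable
  have "AE x in lborel. x \<notin> N" using N(1) by (rule AE_not_in)
  then have ae: "AE x in lebesgue. g x = v x"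
    using eq by (intro AE_completion) (auto simp: g_def)
  have gm: "g \<in> borel_measurable lebesgue" by (intro measurable_completion) simp
  have "integrable lebesgue g"
    using integrable_cong_AE[OF gm _ ae] v by auto
  then have "integrable lborel g" by (subst (asm) integrable_completion) auto
  moreover have "(\<integral>x. g x \<partial>lborel) = (\<integral>x. v x \<partial>lebesgue)"
    using integral_cong_AE[OF gm _ ae] v by (simp add: integral_completion)
  moreover have "v x \<le> g x" for x using N(2) vH by (cases "x \<in> N") (force simp: g_def)+
  ultimately show ?thesis by blast
qed

text \<open>The pure parameters, which put all weight on component \<open>m\<close>, turn the hypotheses on mixtures into
  statements about the single family \<open>f m\<close>. The supremum of the mixtures over the \<open>\<rho>\<close>-ball around the
  pure parameter \<open>(0, 1)\<close> dominates all nearby members of the family, lies below the envelope, and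
  tends to \<open>f m x 0 1\<close> for almost every \<open>x\<close> as \<open>\<rho>\<close> tends to \<open>0\<close>; by dominated convergence its integral tends to \<open>1\<close>.\<close>

lemma local_majorant:
  fixes f :: "('m::finite) families" and m :: 'm
  assumes families: "\<And>m. location_scale_family (f m)"
    and c: "v0 > 0" "v1 > 0" "\<beta> > 1"
    and v0: "\<And>m x. f m x 0 1 \<le> v0"
    and v1: "\<And>m x. x \<noteq> 0 \<Longrightarrow> f m x 0 1 \<le> v1 * \<bar>x\<bar> powr (- \<beta>)"
    and sup_measurable:
      "\<And>\<Gamma> \<theta>. compact \<Gamma> \<Longrightarrow> \<Gamma> \<subseteq> Theta \<Longrightarrow> \<theta> \<in> \<Gamma> \<Longrightarrow>
         \<forall>\<^sub>F \<rho> in at_right 0. (\<lambda>x. mixture_sup f x \<theta> \<rho>) \<in> borel_measurable lebesgue"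
    and param_continuous:
      "\<And>\<Gamma> \<theta>. compact \<Gamma> \<Longrightarrow> \<Gamma> \<subseteq> Theta \<Longrightarrow> \<theta> \<in> \<Gamma> \<Longrightarrow>
         AE x in lborel. \<forall>\<theta>s :: nat \<Rightarrow> 'm param. (\<forall>j. \<theta>s j \<in> \<Gamma>) \<longrightarrow> \<theta>s \<longlonglongrightarrow> \<theta> \<longrightarrow>
           (\<lambda>j. mixture f x (\<theta>s j)) \<longlonglongrightarrow> mixture f x \<theta>"
    and \<epsilon>: "\<epsilon> > 0"
  shows "\<exists>\<rho> g. 0 < \<rho> \<and> integrable lborel g \<and> (\<integral>x. g x \<partial>lborel) \<le> 1 + \<epsilon> \<and>
    (\<forall>x \<mu> \<sigma>. \<bar>\<mu>\<bar> \<le> \<rho> \<longrightarrow> \<bar>\<sigma> - 1\<bar> \<le> \<rho> \<longrightarrow> f m x \<mu> \<sigma> \<le> g x)"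
proof -
  define pure :: "real \<Rightarrow> real \<Rightarrow> 'm param"
    where "pure \<mu> \<sigma> = (\<chi> k. if k = m then (1, \<mu>, \<sigma>) else (0, 0, 1))" for \<mu> \<sigma>
  define H where "H = envelope v0 v1 \<beta>"
  define \<Gamma> where "\<Gamma> = {\<theta> \<in> Theta. dist \<theta> (pure 0 1) \<le> 1 / 2}"
  have H: "integrable lborel H" using integrable_envelope[OF c] by (simp add: H_def)
  have mixture_pure: "mixture f x (pure \<mu> \<sigma>) = f m x \<mu> \<sigma>" for x \<mu> \<sigma>
  proof -
    have "mixture f x (pure \<mu> \<sigma>) = (\<Sum>k\<in>UNIV. if k = m then f m x \<mu> \<sigma> else 0)"
      unfolding mixture_def pure_def by (intro sum.cong) auto
    then show ?thesis by simp
  qed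
  have pure_Theta: "pure \<mu> \<sigma> \<in> Theta" if "\<sigma> > 0" for \<mu> \<sigma>
  proof -
    have "(\<Sum>k\<in>UNIV. weight (pure \<mu> \<sigma> $ k)) = (\<Sum>k\<in>UNIV. if k = m then 1 else 0)"
      unfolding pure_def by (intro sum.cong) auto
    then show ?thesis using that by (auto simp: Theta_def pure_def)
  qed
  have dist_pure: "dist (pure \<mu> \<sigma>) (pure 0 1) \<le> \<bar>\<mu>\<bar> + \<bar>\<sigma> - 1\<bar>" for \<mu> \<sigma>
  proof -
    have "dist (pure \<mu> \<sigma>) (pure 0 1) \<le> (\<Sum>k\<in>UNIV. dist (pure \<mu> \<sigma> $ k) (pure 0 1 $ k))"
      unfolding dist_vec_def by (intro L2_set_le_sum) auto
    also have "\<dots> = (\<Sum>k\<in>UNIV. if k = m then sqrt (\<mu>\<^sup>2 + (\<sigma> - 1)\<^sup>2) else 0)"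
      unfolding pure_def by (intro sum.cong) (auto simp: dist_Pair_Pair dist_real_def)
    also have "\<dots> \<le> \<bar>\<mu>\<bar> + \<bar>\<sigma> - 1\<bar>" by (simp add: sqrt_sum_squares_le_sum_abs)
    finally show ?thesis .
  qed
  have center: "pure 0 1 \<in> \<Gamma>" using pure_Theta[of 1 0] by (simp add: \<Gamma>_def)
  have \<Gamma>_sub: "\<Gamma> \<subseteq> Theta" by (auto simp: \<Gamma>_def)
  have \<Gamma>_compact: "compact \<Gamma>" unfolding \<Gamma>_def
    by (intro compact_Theta_cball) (auto simp: pure_def)
  have upper: "mixture f x \<theta> \<le> H x" if "\<theta> \<in> \<Gamma>" for x \<theta>
  proof -
    have th: "\<theta> \<in> Theta" "dist \<theta> (pure 0 1) \<le> 1 / 2" using that by (auto simp: \<Gamma>_def)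
    have "f k x (loc (\<theta> $ k)) (scale (\<theta> $ k)) \<le> H x" for k
    proof -
      have k: "loc (pure 0 1 $ k) = 0" "scale (pure 0 1 $ k) = 1" by (auto simp: pure_def)
      have "dist (snd (\<theta> $ k)) (snd (pure 0 1 $ k)) \<le> 1 / 2"
        using th(2) by (meson dist_snd_le dist_vec_nth_le order_trans)
      then have "dist (loc (\<theta> $ k)) (loc (pure 0 1 $ k)) \<le> 1 / 2"
        "dist (scale (\<theta> $ k)) (scale (pure 0 1 $ k)) \<le> 1 / 2"
        by (meson dist_snd_le dist_fst_le order_trans)+
      then have "\<bar>loc (\<theta> $ k)\<bar> \<le> 1 / 2" "1 / 2 \<le> scale (\<theta> $ k)" "scale (\<theta> $ k) \<le> 2"
        unfolding k dist_real_def by linarith+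
      then show ?thesis unfolding H_def
        using families c v0 v1 by (intro location_scale_family_le_envelope) auto
    qed
    then have "mixture f x \<theta> \<le> (\<Sum>k\<in>UNIV. weight (\<theta> $ k) * H x)"
      unfolding mixture_def using th(1) by (intro sum_mono mult_left_mono) (auto simp: Theta_def)
    also have "\<dots> = H x" using th(1) by (simp add: Theta_def flip: sum_distrib_right)
    finally show ?thesis .
  qed
  obtain r where r: "r > 0" and
    r_meas: "\<And>\<rho>. 0 < \<rho> \<Longrightarrow> \<rho> < r \<Longrightarrow> (\<lambda>x. mixture_sup f x (pure 0 1) \<rho>) \<in> borel_measurable lebesgue"
    using sup_measurable[OF \<Gamma>_compact \<Gamma>_sub center] unfolding eventually_at_right_field by auto
  define s where "s = min r (1 / 2)"
  have s: "0 < s" "s \<le> r" "s \<le> 1 / 2" using r by (auto simp: s_def)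
  define \<rho> where "\<rho> k = s / (real k + 2)" for k
  have \<rho>_half: "0 < \<rho> k" "\<rho> k \<le> s / 2" for k
    using s divide_left_mono[of 2 "real k + 2" s] by (simp_all add: \<rho>_def)
  have \<rho>: "0 < \<rho> k" "\<rho> k < r" "\<rho> k \<le> 1 / 2" for k
    using \<rho>_half[of k] s by linarith+
  have \<rho>_lim: "\<rho> \<longlonglongrightarrow> 0" unfolding \<rho>_def by real_asymp
  define v where "v k x = real_of_ereal (mixture_sup f x (pure 0 1) (\<rho> k))" for k x
  have in_\<Gamma>: "\<theta> \<in> \<Gamma>" if "\<theta> \<in> Theta" "dist \<theta> (pure 0 1) \<le> \<rho> k" for \<theta> k
    using that \<rho>(3)[of k] by (auto simp: \<Gamma>_def)
  have sup_le: "mixture_sup f x (pure 0 1) (\<rho> k) \<le> ereal (H x)" for k x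
    unfolding mixture_sup_def using in_\<Gamma> upper by (intro SUP_least) auto
  have le_sup: "ereal (mixture f x \<theta>) \<le> mixture_sup f x (pure 0 1) (\<rho> k)"
    if "\<theta> \<in> Theta" "dist \<theta> (pure 0 1) \<le> \<rho> k" for x \<theta> k
    unfolding mixture_sup_def using that by (intro SUP_upper) auto
  have center_le: "ereal (f m x 0 1) \<le> mixture_sup f x (pure 0 1) (\<rho> k)" for x k
    using le_sup[OF pure_Theta, of 1 0 k x] \<rho>(1)[of k] by (simp add: mixture_pure)
  have v_eq: "mixture_sup f x (pure 0 1) (\<rho> k) = ereal (v k x)" for k x
    using sup_le[of x k] center_le[of x k] unfolding v_def
    by (cases "mixture_sup f x (pure 0 1) (\<rho> k)") auto
  have v_le: "v k x \<le> H x" and v_ge: "f m x 0 1 \<le> v k x" for k x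
    using sup_le[of x k] center_le[of x k] unfolding v_eq by auto
  have v0': "0 \<le> v k x" for k x
    using v_ge[of x k] location_scale_family_nonneg[OF families, of 1 m x 0] by simp
  have v_meas: "v k \<in> borel_measurable lebesgue" for k
    using r_meas[OF \<rho>(1,2)[of k]] unfolding v_def by measurable
  have lim: "AE x in lebesgue. (\<lambda>k. v k x) \<longlonglongrightarrow> f m x 0 1"
  proof (rule AE_completion, rule AE_mp[OF param_continuous[OF \<Gamma>_compact \<Gamma>_sub center]], intro AE_I2 impI)
    fix x
    assume cont: "\<forall>\<theta>s. (\<forall>j. \<theta>s j \<in> \<Gamma>) \<longrightarrow> \<theta>s \<longlonglongrightarrow> pure 0 1 \<longrightarrow>
           (\<lambda>j. mixture f x (\<theta>s j)) \<longlonglongrightarrow> mixture f x (pure 0 1)"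
    \<comment> \<open>near-maximizers of the supremum converge to the centre of the balls and squeeze \<open>v k x\<close>\<close>
    have "\<exists>\<theta>. \<theta> \<in> Theta \<and> dist \<theta> (pure 0 1) \<le> \<rho> k \<and> v k x - 1 / (real k + 1) < mixture f x \<theta>" for k
    proof -
      have "ereal (v k x - 1 / (real k + 1)) < mixture_sup f x (pure 0 1) (\<rho> k)"
        unfolding v_eq by simp
      then show ?thesis unfolding mixture_sup_def less_SUP_iff by auto
    qed
    then obtain \<theta>s where \<theta>s: "\<And>k. \<theta>s k \<in> Theta" "\<And>k. dist (\<theta>s k) (pure 0 1) \<le> \<rho> k"
      "\<And>k. v k x - 1 / (real k + 1) < mixture f x (\<theta>s k)" by metis
    have "\<theta>s \<longlonglongrightarrow> pure 0 1"
      using \<theta>s(2) by (intro metric_tendsto_imp_tendsto[OF \<rho>_lim])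
        (auto simp: dist_real_def intro!: always_eventually order_trans[OF _ abs_ge_self])
    then have "(\<lambda>k. mixture f x (\<theta>s k)) \<longlonglongrightarrow> f m x 0 1"
      using cont[rule_format, of \<theta>s] in_\<Gamma>[OF \<theta>s(1,2)] by (simp add: mixture_pure)
    moreover have "(\<lambda>k. 1 / (real k + 1)) \<longlonglongrightarrow> 0" by real_asymp
    ultimately have "(\<lambda>k. mixture f x (\<theta>s k) + 1 / (real k + 1)) \<longlonglongrightarrow> f m x 0 1 + 0"
      by (intro tendsto_add)
    then have lim_upper: "(\<lambda>k. mixture f x (\<theta>s k) + 1 / (real k + 1)) \<longlonglongrightarrow> f m x 0 1"
      by simp
    show "(\<lambda>k. v k x) \<longlonglongrightarrow> f m x 0 1"
    proof (rule tendsto_sandwich[OF _ _ tendsto_const lim_upper])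
      show "\<forall>\<^sub>F k in sequentially. v k x \<le> mixture f x (\<theta>s k) + 1 / (real k + 1)"
        using \<theta>s(3) by (intro always_eventually allI) (simp add: less_imp_le diff_less_eq)
    qed (use v_ge in auto)
  qed
  have H': "integrable lebesgue H"
    using H integrable_completion[of H lborel] by (metis borel_measurable_integrable)
  have fm: "probability_density (\<lambda>x. f m x 0 1)"
    using families[of m] zero_less_one unfolding location_scale_family_def by blast
  have fm_meas: "(\<lambda>x. f m x 0 1) \<in> borel_measurable borel"
    using fm by (simp add: probability_density_def)
  have norm_v: "AE x in lebesgue. norm (v k x) \<le> H x" for k
    using v_le v0' by (intro AE_I2) auto
  have v_int: "integrable lebesgue (v k)" for k
    by (rule Bochner_Integration.integrable_bound[OF H' v_meas])
       (use v_le v0' in \<open>auto intro!: AE_I2 intro: order_trans[OF _ abs_ge_self]\<close>)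
  have "(\<lambda>k. \<integral>x. v k x \<partial>lebesgue) \<longlonglongrightarrow> (\<integral>x. f m x 0 1 \<partial>lebesgue)"
    by (rule integral_dominated_convergence[OF _ v_meas H' lim norm_v])
       (simp add: measurable_completion fm_meas)
  also have "(\<integral>x. f m x 0 1 \<partial>lebesgue) = (\<integral>x. f m x 0 1 \<partial>lborel)"
    using fm_meas by (simp add: integral_completion)
  also have "\<dots> = 1"
    using fm by (simp add: integral_eq_nn_integral probability_density_def)
  finally have "\<forall>\<^sub>F k in sequentially. (\<integral>x. v k x \<partial>lebesgue) < 1 + \<epsilon>"
    using \<epsilon> by (intro order_tendstoD) auto
  then obtain k where k: "(\<integral>x. v k x \<partial>lebesgue) < 1 + \<epsilon>"
    using eventually_happens by fastforce
  obtain g where g: "integrable lborel g" "\<And>x. v k x \<le> g x" "(\<integral>x. g x \<partial>lborel) = (\<integral>x. v k x \<partial>lebesgue)"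
    using ex_borel_majorant[OF v_int H v_le] by blast
  show ?thesis
  proof (intro exI conjI allI impI)
    show "0 < \<rho> k / 2" using \<rho>[of k] by auto
    show "integrable lborel g" "(\<integral>x. g x \<partial>lborel) \<le> 1 + \<epsilon>" using g k by auto
    fix x \<mu> \<sigma> assume near: "\<bar>\<mu>\<bar> \<le> \<rho> k / 2" "\<bar>\<sigma> - 1\<bar> \<le> \<rho> k / 2"
    have "ereal (mixture f x (pure \<mu> \<sigma>)) \<le> ereal (v k x)"
      unfolding v_eq[symmetric]
    proof (rule le_sup)
      show "pure \<mu> \<sigma> \<in> Theta" using near(2) \<rho>(3)[of k] by (intro pure_Theta) linarith
      show "dist (pure \<mu> \<sigma>) (pure 0 1) \<le> \<rho> k" using dist_pure[of \<mu> \<sigma>] near by linarith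
    qed
    then show "f m x \<mu> \<sigma> \<le> g x" using g(2)[of x] by (simp add: mixture_pure)
  qed
qed

section \<open>Brackets of mixtures from brackets of components\<close>

lemma subexp_bracketed_mono:
  assumes "subexp_bracketed D F" "\<And>n. G n \<subseteq> F n"
  shows "subexp_bracketed D G"
  unfolding subexp_bracketed_def
proof (intro allI impI)
  fix \<eta> :: real assume "\<eta> > 0"
  from assms(1)[unfolded subexp_bracketed_def, rule_format, OF this] obtain B
    where B: "\<forall>n. finite (B n)" "subexponential (\<lambda>n. real (card (B n)))"
      "\<forall>\<^sub>F n in sequentially. \<forall>p\<in>F n. \<exists>b\<in>B n. upper_bracket (D n) \<eta> p b"
    by blast
  from B(3) have "\<forall>\<^sub>F n in sequentially. \<forall>p\<in>G n. \<exists>b\<in>B n. upper_bracket (D n) \<eta> p b"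
    by (rule eventually_mono) (use assms(2) in blast)
  with B(1,2) show "\<exists>B. (\<forall>n. finite (B n)) \<and> subexponential (\<lambda>n. real (card (B n))) \<and>
      (\<forall>\<^sub>F n in sequentially. \<forall>p\<in>G n. \<exists>b\<in>B n. upper_bracket (D n) \<eta> p b)"
    by blast
qed

lemma upper_bracket_sum:
  fixes p b :: "'m \<Rightarrow> real \<Rightarrow> real"
  assumes "finite I" and b: "\<And>m. m \<in> I \<Longrightarrow> upper_bracket D (\<eta> m) (p m) (b m)"
    and p: "\<And>m. m \<in> I \<Longrightarrow> integrable lborel (p m)" and D [measurable]: "D \<in> sets borel"
  shows "upper_bracket D (\<Sum>m\<in>I. \<eta> m) (\<lambda>x. \<Sum>m\<in>I. p m x) (\<lambda>x. \<Sum>m\<in>I. b m x)"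
proof -
  have int: "integrable lborel (\<lambda>x. indicator D x * (b m x - p m x))" if "m \<in> I" for m
    using b[OF that] p[OF that]
    by (intro integrable_indicator_mult)
       (auto simp: upper_bracket_def)
  have "(\<integral>x. indicator D x * ((\<Sum>m\<in>I. b m x) - (\<Sum>m\<in>I. p m x)) \<partial>lborel) =
      (\<integral>x. (\<Sum>m\<in>I. indicator D x * (b m x - p m x)) \<partial>lborel)"
    by (simp add: sum_subtractf sum_distrib_left right_diff_distrib)
  also have "\<dots> = (\<Sum>m\<in>I. \<integral>x. indicator D x * (b m x - p m x) \<partial>lborel)"
    using int by (intro Bochner_Integration.integral_sum)
  also have "\<dots> \<le> (\<Sum>m\<in>I. \<eta> m)"
    using b by (intro sum_mono) (auto simp: upper_bracket_def)
  finally show ?thesis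
    using b by (auto simp: upper_bracket_def intro!: Bochner_Integration.integrable_sum sum_nonneg sum_mono)
qed

text \<open>Each summand is bracketed with an equal share of \<open>\<eta>\<close>. The number of sums of brackets is at most a product
  with a fixed finite number of factors, and such products stay subexponential.\<close>

lemma subexp_bracketed_sum:
  fixes F :: "'m::finite \<Rightarrow> nat \<Rightarrow> (real \<Rightarrow> real) set"
  assumes br: "\<And>m. subexp_bracketed D (F m)"
    and int: "\<And>m n p. p \<in> F m n \<Longrightarrow> integrable lborel p"
    and D: "\<And>n. D n \<in> sets borel"
  shows "subexp_bracketed D (\<lambda>n. {(\<lambda>x. \<Sum>m\<in>UNIV. p m x) | p. \<forall>m. p m \<in> F m n})"
  unfolding subexp_bracketed_def
proof (intro allI impI)
  fix \<eta> :: real assume "\<eta> > 0"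
  then have "\<eta> / real CARD('m) > 0" by simp
  then have "\<forall>m. \<exists>B. (\<forall>n. finite (B n)) \<and> subexponential (\<lambda>n. real (card (B n))) \<and>
      (\<forall>\<^sub>F n in sequentially. \<forall>p\<in>F m n. \<exists>b\<in>B n. upper_bracket (D n) (\<eta> / real CARD('m)) p b)"
    using br unfolding subexp_bracketed_def by blast
  from choice[OF this] obtain B
    where fin: "\<And>m n. finite (B m n)" and card: "\<And>m. subexponential (\<lambda>n. real (card (B m n)))"
      and cover: "\<And>m. \<forall>\<^sub>F n in sequentially. \<forall>p\<in>F m n. \<exists>b\<in>B m n. upper_bracket (D n) (\<eta> / real CARD('m)) p b"
    by blast
  define S :: "('m \<Rightarrow> real \<Rightarrow> real) \<Rightarrow> real \<Rightarrow> real" where "S b x = (\<Sum>m\<in>UNIV. b m x)" for b x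
  define C where "C n = S ` (\<Pi>\<^sub>E m\<in>UNIV. B m n)" for n
  have "finite (C n)" for n unfolding C_def using fin by (intro finite_imageI finite_PiE) auto
  moreover have "subexponential (\<lambda>n. real (card (C n)))"
  proof (rule subexponential_mono)
    show "subexponential (\<lambda>n. \<Prod>m\<in>UNIV. real (card (B m n)))"
      using card by (intro subexponential_prod) auto
    have "card (C n) \<le> (\<Prod>m\<in>UNIV. card (B m n))" for n
      unfolding C_def using card_image_le[of "\<Pi>\<^sub>E m\<in>UNIV. B m n" S] fin
      by (simp add: card_PiE finite_PiE)
    then show "\<forall>\<^sub>F n in sequentially. real (card (C n)) \<le> (\<Prod>m\<in>UNIV. real (card (B m n)))"
      by (intro always_eventually allI) (simp flip: of_nat_prod)
  qed
  moreover have "\<forall>\<^sub>F n in sequentially. \<forall>q\<in>{(\<lambda>x. \<Sum>m\<in>UNIV. p m x) | p. \<forall>m. p m \<in> F m n}.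
      \<exists>b\<in>C n. upper_bracket (D n) \<eta> q b"
  proof -
    have "\<forall>\<^sub>F n in sequentially. \<forall>m. \<forall>p\<in>F m n. \<exists>b\<in>B m n. upper_bracket (D n) (\<eta> / real CARD('m)) p b"
      using cover by (intro eventually_all_finite) auto
    then show ?thesis
    proof eventually_elim
      case (elim n)
      show ?case
      proof
        fix q assume "q \<in> {(\<lambda>x. \<Sum>m\<in>UNIV. p m x) | p. \<forall>m. p m \<in> F m n}"
        then obtain p where q: "q = (\<lambda>x. \<Sum>m\<in>UNIV. p m x)" and p: "\<And>m. p m \<in> F m n" by blast
        have "\<forall>m. \<exists>b. b \<in> B m n \<and> upper_bracket (D n) (\<eta> / real CARD('m)) (p m) b"
          using elim p by blast
        from choice[OF this] obtain b where b: "\<And>m. b m \<in> B m n"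
          "\<And>m. upper_bracket (D n) (\<eta> / real CARD('m)) (p m) (b m)" by blast
        have "upper_bracket (D n) (\<Sum>m\<in>(UNIV::'m set). \<eta> / real CARD('m)) q (S b)"
          unfolding q S_def using b(2) int[OF p] D by (intro upper_bracket_sum) auto
        moreover have "S b \<in> C n" unfolding C_def using b(1) by auto
        ultimately show "\<exists>b\<in>C n. upper_bracket (D n) \<eta> q b" by auto
      qed
    qed
  qed
  ultimately show "\<exists>B. (\<forall>n. finite (B n)) \<and> subexponential (\<lambda>n. real (card (B n))) \<and>
      (\<forall>\<^sub>F n in sequentially. \<forall>q\<in>{(\<lambda>x. \<Sum>m\<in>UNIV. p m x) | p. \<forall>m. p m \<in> F m n}.
        \<exists>b\<in>B n. upper_bracket (D n) \<eta> q b)"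
    by blast
qed

section \<open>Brackets of the components\<close>

lemma location_scale_family_density:
  assumes "location_scale_family f" "\<sigma> > 0"
  shows "probability_density (\<lambda>x. f x \<mu> \<sigma>)"
  using assms unfolding location_scale_family_def by blast

text \<open>Inside \<open>D\<close> the excess of the bracket is at most its excess on the whole line, because it is
  nonnegative everywhere; the latter is the difference of the total masses.\<close>

lemma upper_bracket_scaled_majorant:
  assumes f: "location_scale_family f" and g: "integrable lborel g" "(\<integral>x. g x \<partial>lborel) \<le> 1 + \<epsilon>"
    and maj: "\<And>x \<mu> \<sigma>. \<bar>\<mu>\<bar> \<le> \<rho> \<Longrightarrow> \<bar>\<sigma> - 1\<bar> \<le> \<rho> \<Longrightarrow> f x \<mu> \<sigma> \<le> g x"
    and s: "s > 0" and \<mu>: "\<bar>\<mu> - a\<bar> \<le> \<rho> * s" and \<sigma>: "\<sigma> > 0" "\<bar>\<sigma> - s\<bar> \<le> \<rho> * s"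
    and \<alpha>: "0 \<le> \<alpha>" "\<alpha> \<le> w" and D [measurable]: "D \<in> sets borel"
  shows "upper_bracket D (w * (1 + \<epsilon>) - \<alpha>) (\<lambda>x. \<alpha> * f x \<mu> \<sigma>) (\<lambda>x. w * (1 / s * g ((x - a) / s)))"
proof -
  define G where "G x = 1 / s * g ((x - a) / s)" for x
  have affine: "(x - a) / s = - a / s + 1 / s * x" for x using s by (simp add: field_simps)
  have G_int: "integrable lborel G" unfolding G_def affine
    using s g(1) by (intro integrable_mult_right lborel_integrable_real_affine) auto
  have "(\<integral>x. g x \<partial>lborel) = (\<integral>x. G x \<partial>lborel)" unfolding G_def affine
    using s lborel_integral_real_affine[of "1 / s" g "- a / s"] by simp
  then have G_le: "(\<integral>x. G x \<partial>lborel) \<le> 1 + \<epsilon>" using g(2) by simp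
  have f_le: "f x \<mu> \<sigma> \<le> G x" for x
  proof -
    have "\<bar>(\<mu> - a) / s\<bar> \<le> \<rho>" using \<mu> s by (simp add: abs_divide pos_divide_le_eq)
    moreover have "\<bar>\<sigma> / s - 1\<bar> \<le> \<rho>"
    proof -
      have "\<sigma> / s - 1 = (\<sigma> - s) / s" using s by (simp add: diff_divide_distrib)
      then show ?thesis using \<sigma>(2) s by (simp add: abs_divide pos_divide_le_eq)
    qed
    ultimately show ?thesis
      unfolding G_def location_scale_family_rescale[OF f \<sigma>(1) s, of x \<mu> a]
      using s by (intro mult_left_mono maj) auto
  qed
  have f0: "0 \<le> f x \<mu> \<sigma>" for x using location_scale_family_nonneg[OF f \<sigma>(1)] .
  have G0: "0 \<le> G x" for x using f0[of x] f_le[of x] by linarith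
  have p_le: "\<alpha> * f x \<mu> \<sigma> \<le> w * G x" for x
    using \<alpha> f_le f0 by (intro mult_mono) auto
  note [simp] = probability_density_integral[OF location_scale_family_density[OF f \<sigma>(1)]]
  have "(\<integral>x. indicator D x * (w * G x - \<alpha> * f x \<mu> \<sigma>) \<partial>lborel) \<le> (\<integral>x. w * G x - \<alpha> * f x \<mu> \<sigma> \<partial>lborel)"
  proof (rule integral_mono)
    show "integrable lborel (\<lambda>x. w * G x - \<alpha> * f x \<mu> \<sigma>)" using G_int by simp
    then show "integrable lborel (\<lambda>x. indicator D x * (w * G x - \<alpha> * f x \<mu> \<sigma>))"
      by (intro integrable_indicator_mult) auto
    show "indicator D x * (w * G x - \<alpha> * f x \<mu> \<sigma>) \<le> w * G x - \<alpha> * f x \<mu> \<sigma>" for x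
      using p_le[of x] by (auto simp: indicator_def)
  qed
  also have "\<dots> = w * (\<integral>x. G x \<partial>lborel) - \<alpha>" using G_int by simp
  also have "\<dots> \<le> w * (1 + \<epsilon>) - \<alpha>" using G_le \<alpha> by (simp add: mult_left_mono)
  finally show ?thesis
    using G_int G0 \<alpha> p_le unfolding upper_bracket_def G_def[symmetric] by auto
qed

text \<open>A large scale makes the density flat. If the scale is at most \<open>S\<close> but the location is at distance
  at least \<open>S\<close> from the interval, the tail bound is largest for \<open>\<sigma> = S\<close> and distance \<open>S\<close>, where it
  equals \<open>v1 / S\<close>.\<close>

lemma location_scale_family_le_outer:
  assumes f: "location_scale_family f" and c: "v0 > 0" "v1 > 0" "\<beta> > 1"
    and v0: "\<And>x. f x 0 1 \<le> v0"
    and v1: "\<And>x. x \<noteq> 0 \<Longrightarrow> f x 0 1 \<le> v1 * \<bar>x\<bar> powr (- \<beta>)"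
    and \<sigma>: "\<sigma> > 0" and S: "S > 0" and out: "S < \<sigma> \<or> S + R < \<bar>\<mu>\<bar>" and x: "\<bar>x\<bar> \<le> R"
  shows "f x \<mu> \<sigma> \<le> (v0 + v1) / S"
proof (cases "S < \<sigma>")
  case True
  have "f x \<mu> \<sigma> \<le> v0 / \<sigma>" using f v0 \<sigma> by (intro location_scale_family_le_const) auto
  also have "\<dots> \<le> (v0 + v1) / S" using True S c by (intro frac_le) auto
  finally show ?thesis .
next
  case False
  then have far: "S \<le> \<bar>x - \<mu>\<bar>" using out x by linarith
  have "f x \<mu> \<sigma> \<le> v1 * \<sigma> powr (\<beta> - 1) * \<bar>x - \<mu>\<bar> powr (- \<beta>)"
    using f v1 \<sigma> far S by (intro location_scale_family_le_tail) auto
  also have "\<dots> \<le> v1 * S powr (\<beta> - 1) * S powr (- \<beta>)"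
    using c \<sigma> far False S by (intro mult_mono powr_mono2 powr_mono2') auto
  also have "\<dots> = v1 * (S powr (\<beta> - 1) * S powr (- \<beta>))" by simp
  also have "S powr (\<beta> - 1) * S powr (- \<beta>) = 1 / S"
    using S by (simp add: powr_minus_divide powr_diff)
  also have "v1 * (1 / S) \<le> (v0 + v1) / S" using c S by (simp add: divide_right_mono)
  finally show ?thesis .
qed

lemma upper_bracket_outer:
  assumes "\<And>x. \<bar>x\<bar> \<le> R \<Longrightarrow> p x \<le> h" "\<And>x. 0 \<le> p x" "integrable lborel p" "0 \<le> h" "0 \<le> R"
  shows "upper_bracket {-R..R} (2 * R * h) p (\<lambda>x. h * indicator {-R..R} x)"
proof -
  have b: "integrable lborel (\<lambda>x. h * indicator {-R..R} x)" by (intro integrable_mult_right integrable_real_indicator) (auto simp: emeasure_lborel_Icc_eq)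
  have "(\<integral>x. indicator {-R..R} x * (h * indicator {-R..R} x - p x) \<partial>lborel) \<le>
      (\<integral>x. h * indicator {-R..R} x \<partial>lborel)"
  proof (rule integral_mono)
    show "integrable lborel (\<lambda>x. indicator {-R..R} x * (h * indicator {-R..R} x - p x))"
      using b assms(3)
      by (intro integrable_indicator_mult) auto
  qed (use assms b in \<open>auto simp: indicator_def\<close>)
  also have "\<dots> = 2 * R * h" using assms(5) by simp
  finally show ?thesis using b assms by (auto simp: upper_bracket_def abs_le_iff)
qed

text \<open>The brackets are the multiples, with weights on the grid of mesh \<open>1 / L\<close>, of the translated and
  dilated local majorants with centre and dilation on the grid of mesh \<open>\<rho> * c n\<close>, and one constant
  function for the parameters with \<open>\<sigma> > (R n)\<^sup>2\<close> or \<open>\<bar>\<mu>\<bar> > (R n)\<^sup>2 + R n\<close>. Since all scales are at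
  least \<open>c n\<close>, one mesh is fine enough for all of them.\<close>

lemma component_bracketed:
  fixes f :: "real \<Rightarrow> real \<Rightarrow> real \<Rightarrow> real" and R c :: "nat \<Rightarrow> real"
  assumes f: "location_scale_family f" and v: "v0 > 0" "v1 > 0" "\<beta> > 1"
    and v0: "\<And>x. f x 0 1 \<le> v0"
    and v1: "\<And>x. x \<noteq> 0 \<Longrightarrow> f x 0 1 \<le> v1 * \<bar>x\<bar> powr (- \<beta>)"
    and maj: "\<And>\<epsilon>. \<epsilon> > 0 \<Longrightarrow> \<exists>\<rho> g. 0 < \<rho> \<and> integrable lborel g \<and>
      (\<integral>x. g x \<partial>lborel) \<le> 1 + \<epsilon> \<and> (\<forall>x \<mu> \<sigma>. \<bar>\<mu>\<bar> \<le> \<rho> \<longrightarrow> \<bar>\<sigma> - 1\<bar> \<le> \<rho> \<longrightarrow> f x \<mu> \<sigma> \<le> g x)"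
    and R: "\<And>n. 0 \<le> R n" "filterlim R at_top sequentially" "subexponential R"
    and c: "\<And>n. 0 < c n" "subexponential (\<lambda>n. 1 / c n)"
  shows "subexp_bracketed (\<lambda>n. {-R n..R n})
    (\<lambda>n. {(\<lambda>x. \<alpha> * f x \<mu> \<sigma>) | \<alpha> \<mu> \<sigma>. 0 \<le> \<alpha> \<and> \<alpha> \<le> 1 \<and> c n \<le> \<sigma>})"
    (is "subexp_bracketed ?D ?F")
  unfolding subexp_bracketed_def
proof (intro allI impI)
  fix \<eta> :: real assume \<eta>: "\<eta> > 0"
  define \<epsilon> where "\<epsilon> = \<eta> / 2"
  have \<epsilon>: "\<epsilon> > 0" using \<eta> by (simp add: \<epsilon>_def)
  obtain \<rho> g where \<rho>: "0 < \<rho>" and g: "integrable lborel g" "(\<integral>x. g x \<partial>lborel) \<le> 1 + \<epsilon>"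
    and g_maj: "\<And>x \<mu> \<sigma>. \<bar>\<mu>\<bar> \<le> \<rho> \<Longrightarrow> \<bar>\<sigma> - 1\<bar> \<le> \<rho> \<Longrightarrow> f x \<mu> \<sigma> \<le> g x"
    using maj[OF \<epsilon>] by blast
  \<comment> \<open>rounding a weight up to a multiple of \<open>1 / L\<close> adds at most \<open>\<epsilon>\<close> to the mass of a bracket\<close>
  obtain L :: nat where L: "(1 + \<epsilon>) / \<epsilon> < real L" using reals_Archimedean2 by blast
  have "0 < (1 + \<epsilon>) / \<epsilon>" using \<epsilon> by simp
  then have L0: "0 < real L" using L by linarith
  have L_small: "1 / real L * (1 + \<epsilon>) \<le> \<epsilon>" using L L0 \<epsilon> by (simp add: field_simps)
  define step where "step n = \<rho> * c n" for n
  have step: "step n > 0" for n using \<rho> c(1) by (simp add: step_def)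
  \<comment> \<open>\<open>N n * step n\<close> is at least every scale and every absolute location in the inner region\<close>
  define N where "N n = nat \<lceil>((R n)\<^sup>2 + R n) / step n\<rceil>" for n
  have N_ge: "((R n)\<^sup>2 + R n) / step n \<le> real (N n)" for n
    unfolding N_def by (rule real_nat_ceiling_ge)
  define G where "G n k i j x = real k / real L *
      (1 / (step n * real j) * g ((x - step n * of_int i) / (step n * real j)))"
    for n and k :: nat and i :: int and j :: nat and x
  define I where "I n = {..L} \<times> {- int (N n)..int (N n)} \<times> {..N n}" for n
  define B where "B n = insert (\<lambda>x. (v0 + v1) / (R n)\<^sup>2 * indicator {-R n..R n} x)
      ((\<lambda>(k, i, j). G n k i j) ` I n)" for n
  have "finite (B n)" for n by (simp add: B_def I_def)
  moreover have "subexponential (\<lambda>n. real (card (B n)))"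
  proof (rule subexponential_mono)
    have "subexponential (\<lambda>n. real (N n))"
    proof (rule subexponential_mono)
      show "subexponential (\<lambda>n. (R n * R n + R n) * (1 / \<rho> * (1 / c n)) + 1)"
        using R c(1) \<rho>
        by (intro subexponential_add subexponential_mult subexponential_const c(2)) (auto simp: less_imp_le)
      have "real (N n) \<le> (R n * R n + R n) * (1 / \<rho> * (1 / c n)) + 1" for n
      proof -
        have "0 \<le> ((R n)\<^sup>2 + R n) / step n" using R(1) step[of n] by simp
        then have "real (N n) = of_int \<lceil>((R n)\<^sup>2 + R n) / step n\<rceil>" by (simp add: N_def)
        then show ?thesis by (simp add: step_def power2_eq_square)
      qed
      then show "\<forall>\<^sub>F n in sequentially. real (N n) \<le> (R n * R n + R n) * (1 / \<rho> * (1 / c n)) + 1"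
        by simp
    qed
    then show "subexponential (\<lambda>n. real (L + 1) * ((2 * real (N n) + 1) * (real (N n) + 1)) + 1)"
      by (intro subexponential_add subexponential_mult subexponential_const) auto
    have "card (B n) \<le> card (I n) + 1" for n
    proof -
      have "card (B n) \<le> Suc (card ((\<lambda>(k, i, j). G n k i j) ` I n))"
        unfolding B_def by (rule card_insert_le_m1) auto
      also have "\<dots> \<le> Suc (card (I n))" using card_image_le[of "I n"] by (simp add: I_def)
      finally show ?thesis by simp
    qed
    moreover have "card (I n) = (L + 1) * ((2 * N n + 1) * (N n + 1))" for n
    proof -
      have "card {- int (N n)..int (N n)} = nat (2 * int (N n) + 1)" by simp
      also have "\<dots> = 2 * N n + 1" by arith
      finally show ?thesis unfolding I_def card_cartesian_product by simp
    qed
    ultimately have "card (B n) \<le> (L + 1) * ((2 * N n + 1) * (N n + 1)) + 1" for n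
      by metis
    then have "real (card (B n)) \<le> real ((L + 1) * ((2 * N n + 1) * (N n + 1)) + 1)" for n
      by (simp only: of_nat_le_iff)
    then show "\<forall>\<^sub>F n in sequentially. real (card (B n)) \<le>
        real (L + 1) * ((2 * real (N n) + 1) * (real (N n) + 1)) + 1"
      by (intro always_eventually allI) (simp add: algebra_simps)
  qed
  moreover have "\<forall>\<^sub>F n in sequentially. \<forall>p\<in>?F n. \<exists>b\<in>B n. upper_bracket (?D n) \<eta> p b"
  proof -
    have "\<forall>\<^sub>F n in sequentially. max 1 (2 * (v0 + v1) / \<eta>) \<le> R n"
      using R(2) unfolding filterlim_at_top by blast
    then show ?thesis
    proof eventually_elim
      case (elim n)
      then have Rn: "1 \<le> R n" "2 * (v0 + v1) / \<eta> \<le> R n" by auto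
      show ?case
      proof
        fix p assume "p \<in> ?F n"
        then obtain \<alpha> \<mu> \<sigma> where p: "p = (\<lambda>x. \<alpha> * f x \<mu> \<sigma>)" and \<alpha>: "0 \<le> \<alpha>" "\<alpha> \<le> 1" and \<sigma>: "c n \<le> \<sigma>"
          by blast
        have \<sigma>0: "\<sigma> > 0" using \<sigma> c(1)[of n] by linarith
        show "\<exists>b\<in>B n. upper_bracket (?D n) \<eta> p b"
        proof (cases "\<sigma> \<le> (R n)\<^sup>2 \<and> \<bar>\<mu>\<bar> \<le> (R n)\<^sup>2 + R n")
          case True
          \<comment> \<open>weight and scale are rounded up: the bracket must not be smaller than the density,
            and \<open>c n \<le> s\<close> makes the mesh \<open>\<rho> * c n\<close> at most \<open>\<rho> * s\<close>\<close>
          define k where "k = nat \<lceil>\<alpha> * real L\<rceil>"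
          define i where "i = \<lfloor>\<mu> / step n\<rfloor>"
          define j where "j = nat \<lceil>\<sigma> / step n\<rceil>"
          define s where "s = step n * real j"
          have "real k = of_int \<lceil>\<alpha> * real L\<rceil>" using \<alpha> by (simp add: k_def)
          then have "\<alpha> * real L \<le> real k" "real k \<le> \<alpha> * real L + 1" by linarith+
          then have w: "\<alpha> \<le> real k / real L" "real k / real L \<le> \<alpha> + 1 / real L"
            using L0 by (simp_all add: field_simps)
          have k_le: "k \<le> L" unfolding k_def using \<alpha> L0
            by (simp add: nat_le_iff ceiling_le_iff mult_left_le_one_le)
          have "of_int i \<le> \<mu> / step n" "\<mu> / step n \<le> of_int i + 1" unfolding i_def by linarith+
          then have i_near: "step n * of_int i \<le> \<mu>" "\<mu> \<le> step n * of_int i + step n"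
            using step[of n] by (simp_all add: field_simps)
          have "\<bar>\<mu> / step n\<bar> \<le> real (N n)"
            using True step[of n] N_ge[of n] divide_right_mono[of "\<bar>\<mu>\<bar>" "(R n)\<^sup>2 + R n" "step n"]
            by (simp add: abs_divide)
          then have "- real (N n) \<le> \<mu> / step n" "\<mu> / step n < real (N n) + 1" by linarith+
          then have i_in: "i \<in> {- int (N n)..int (N n)}"
            unfolding i_def by (simp add: le_floor_iff floor_le_iff)
          have "0 \<le> \<sigma> / step n" using \<sigma>0 step[of n] by simp
          then have "real j = of_int \<lceil>\<sigma> / step n\<rceil>" by (simp add: j_def)
          then have "\<sigma> / step n \<le> real j" "real j \<le> \<sigma> / step n + 1" by linarith+
          then have j_near: "\<sigma> \<le> s" "s \<le> \<sigma> + step n"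
            using step[of n] by (simp_all add: field_simps s_def)
          have "\<sigma> / step n \<le> real (N n)"
            using True R(1)[of n] step[of n] N_ge[of n]
              divide_right_mono[of \<sigma> "(R n)\<^sup>2 + R n" "step n"] by simp
          then have j_in: "j \<le> N n" unfolding j_def by (simp add: nat_le_iff ceiling_le_iff)
          have s0: "s > 0" using j_near \<sigma>0 by linarith
          have "c n \<le> s" using j_near \<sigma> by linarith
          then have step_le: "step n \<le> \<rho> * s" using \<rho> by (simp add: step_def)
          have "upper_bracket (?D n) (real k / real L * (1 + \<epsilon>) - \<alpha>) p (G n k i j)"
            unfolding p G_def[abs_def] s_def[symmetric]
          proof (rule upper_bracket_scaled_majorant[OF f g g_maj s0 _ \<sigma>0 _ \<alpha>(1) w(1)])
            show "\<bar>\<mu> - step n * of_int i\<bar> \<le> \<rho> * s" "\<bar>\<sigma> - s\<bar> \<le> \<rho> * s"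
              using i_near j_near step_le by linarith+
          qed auto
          moreover have "real k / real L * (1 + \<epsilon>) - \<alpha> \<le> \<eta>"
          proof -
            have "real k / real L * (1 + \<epsilon>) \<le> (\<alpha> + 1 / real L) * (1 + \<epsilon>)"
              using w(2) \<epsilon> by (intro mult_right_mono) auto
            also have "\<dots> = \<alpha> + \<alpha> * \<epsilon> + 1 / real L * (1 + \<epsilon>)" by (simp add: algebra_simps)
            also have "\<alpha> * \<epsilon> \<le> \<epsilon>" using \<alpha> \<epsilon> by (simp add: mult_left_le_one_le)
            finally have "real k / real L * (1 + \<epsilon>) - \<alpha> \<le> \<epsilon> + \<epsilon>" using L_small by linarith
            then show ?thesis by (simp add: \<epsilon>_def)
          qed
          ultimately have "upper_bracket (?D n) \<eta> p (G n k i j)"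
            by (auto simp: upper_bracket_def)
          moreover have "(k, i, j) \<in> I n" using k_le i_in j_in by (simp add: I_def)
          then have "G n k i j \<in> B n" unfolding B_def by (intro insertI2 image_eqI[of _ _ "(k, i, j)"]) auto
          ultimately show ?thesis by blast
        next
          case False
          have R2: "(R n)\<^sup>2 > 0" using Rn(1) by simp
          have f_le: "f x \<mu> \<sigma> \<le> (v0 + v1) / (R n)\<^sup>2" if "\<bar>x\<bar> \<le> R n" for x
            using False that by (intro location_scale_family_le_outer[OF f v v0 v1 \<sigma>0 R2]) auto
          have f0: "0 \<le> f x \<mu> \<sigma>" for x by (rule location_scale_family_nonneg[OF f \<sigma>0])
          have "upper_bracket (?D n) (2 * R n * ((v0 + v1) / (R n)\<^sup>2)) p
              (\<lambda>x. (v0 + v1) / (R n)\<^sup>2 * indicator {-R n..R n} x)"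
          proof (rule upper_bracket_outer)
            fix x assume "\<bar>x\<bar> \<le> R n"
            have "\<alpha> * f x \<mu> \<sigma> \<le> f x \<mu> \<sigma>" using \<alpha> f0 by (simp add: mult_left_le_one_le)
            also have "\<dots> \<le> (v0 + v1) / (R n)\<^sup>2" using f_le[OF \<open>\<bar>x\<bar> \<le> R n\<close>] .
            finally show "p x \<le> (v0 + v1) / (R n)\<^sup>2" by (simp add: p)
          next
            show "integrable lborel p" unfolding p
              using probability_density_integral[OF location_scale_family_density[OF f \<sigma>0]] by simp
          qed (use \<alpha> f0 v Rn in \<open>auto simp: p\<close>)
          moreover have "2 * R n * ((v0 + v1) / (R n)\<^sup>2) \<le> \<eta>"
          proof -
            have "2 * R n * ((v0 + v1) / (R n)\<^sup>2) = 2 * (v0 + v1) / R n"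
              using Rn(1) by (simp add: power2_eq_square)
            also have "\<dots> \<le> \<eta>" using Rn \<eta> by (simp add: pos_divide_le_eq mult.commute)
            finally show ?thesis .
          qed
          ultimately have "upper_bracket (?D n) \<eta> p (\<lambda>x. (v0 + v1) / (R n)\<^sup>2 * indicator {-R n..R n} x)"
            by (auto simp: upper_bracket_def)
          then show ?thesis unfolding B_def by blast
        qed
      qed
    qed
  qed
  ultimately show "\<exists>B. (\<forall>n. finite (B n)) \<and> subexponential (\<lambda>n. real (card (B n))) \<and>
      (\<forall>\<^sub>F n in sequentially. \<forall>p\<in>?F n. \<exists>b\<in>B n. upper_bracket (?D n) \<eta> p b)"
    by blast
qed

section \<open>The sample and its maximum likelihood estimator\<close>

lemma probability_density_mixture:
  fixes f :: "('m::finite) families"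
  assumes f: "\<And>m. location_scale_family (f m)" and \<theta>: "\<theta> \<in> Theta"
  shows "probability_density (\<lambda>x. mixture f x \<theta>)"
proof -
  have comp: "probability_density (\<lambda>x. f m x (loc (\<theta> $ m)) (scale (\<theta> $ m)))" for m
    using \<theta> by (intro location_scale_family_density f) (auto simp: Theta_def)
  have w: "0 \<le> weight (\<theta> $ m)" for m using \<theta> by (simp add: Theta_def)
  have [measurable]: "(\<lambda>x. f m x (loc (\<theta> $ m)) (scale (\<theta> $ m))) \<in> borel_measurable borel" for m
    using comp by (simp add: probability_density_def)
  have f0: "0 \<le> f m x (loc (\<theta> $ m)) (scale (\<theta> $ m))" for m x
    using comp by (simp add: probability_density_def)
  have "(\<integral>\<^sup>+x. ennreal (mixture f x \<theta>) \<partial>lborel) =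
      (\<integral>\<^sup>+x. (\<Sum>m\<in>UNIV. ennreal (weight (\<theta> $ m)) * ennreal (f m x (loc (\<theta> $ m)) (scale (\<theta> $ m)))) \<partial>lborel)"
    unfolding mixture_def using w f0
    by (intro nn_integral_cong) (simp add: sum_ennreal[symmetric] ennreal_mult)
  also have "\<dots> = (\<Sum>m\<in>UNIV. ennreal (weight (\<theta> $ m)) *
      (\<integral>\<^sup>+x. ennreal (f m x (loc (\<theta> $ m)) (scale (\<theta> $ m))) \<partial>lborel))"
    by (simp add: nn_integral_sum nn_integral_cmult)
  also have "\<dots> = ennreal (\<Sum>m\<in>UNIV. weight (\<theta> $ m))"
    using comp w by (simp add: probability_density_def sum_ennreal)
  also have "\<dots> = 1" using \<theta> by (simp add: Theta_def)
  finally show ?thesis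
    using w f0 unfolding probability_density_def mixture_def by (auto intro!: sum_nonneg)
qed

lemma mixture_tail:
  fixes f :: "('m::finite) families"
  assumes f: "\<And>m. location_scale_family (f m)" and \<theta>: "\<theta> \<in> Theta" and v: "v1 > 0" "\<beta> > 1"
    and v1: "\<And>m x. x \<noteq> 0 \<Longrightarrow> f m x 0 1 \<le> v1 * \<bar>x\<bar> powr (- \<beta>)"
  shows "\<exists>C r. 0 \<le> C \<and> (\<forall>x. r \<le> \<bar>x\<bar> \<longrightarrow> mixture f x \<theta> \<le> C * \<bar>x\<bar> powr (- \<beta>))"
proof (intro exI conjI allI impI)
  let ?r = "1 + (\<Sum>m\<in>UNIV. 2 * \<bar>loc (\<theta> $ m)\<bar>)"
  let ?C = "\<Sum>m\<in>UNIV. weight (\<theta> $ m) * (v1 * scale (\<theta> $ m) powr (\<beta> - 1) * 2 powr \<beta>)"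
  show "0 \<le> ?C" using \<theta> v by (intro sum_nonneg) (auto simp: Theta_def)
  fix x assume x: "?r \<le> \<bar>x\<bar>"
  have "mixture f x \<theta> \<le> (\<Sum>m\<in>UNIV. weight (\<theta> $ m) * (v1 * scale (\<theta> $ m) powr (\<beta> - 1) * 2 powr \<beta> * \<bar>x\<bar> powr (- \<beta>)))"
    unfolding mixture_def
  proof (intro sum_mono mult_left_mono)
    fix m
    have \<sigma>: "0 < scale (\<theta> $ m)" and "0 \<le> weight (\<theta> $ m)" using \<theta> by (auto simp: Theta_def)
    then show "0 \<le> weight (\<theta> $ m)" by simp
    have "2 * \<bar>loc (\<theta> $ m)\<bar> \<le> (\<Sum>m\<in>UNIV. 2 * \<bar>loc (\<theta> $ m)\<bar>)"
      by (intro member_le_sum) auto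
    then have x1: "1 \<le> \<bar>x\<bar>" and far: "\<bar>x\<bar> / 2 \<le> \<bar>x - loc (\<theta> $ m)\<bar>" using x by linarith+
    have "f m x (loc (\<theta> $ m)) (scale (\<theta> $ m)) \<le>
        v1 * scale (\<theta> $ m) powr (\<beta> - 1) * \<bar>x - loc (\<theta> $ m)\<bar> powr (- \<beta>)"
      using \<sigma> x1 far v1 by (intro location_scale_family_le_tail f) auto
    also have "\<dots> \<le> v1 * scale (\<theta> $ m) powr (\<beta> - 1) * (\<bar>x\<bar> / 2) powr (- \<beta>)"
      using x1 far v by (intro mult_left_mono powr_mono2') auto
    also have "(\<bar>x\<bar> / 2) powr (- \<beta>) = 2 powr \<beta> * \<bar>x\<bar> powr (- \<beta>)"
      by (simp add: powr_divide powr_minus field_simps)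
    finally show "f m x (loc (\<theta> $ m)) (scale (\<theta> $ m)) \<le>
        v1 * scale (\<theta> $ m) powr (\<beta> - 1) * 2 powr \<beta> * \<bar>x\<bar> powr (- \<beta>)"
      by (simp add: mult.assoc)
  qed
  also have "\<dots> = ?C * \<bar>x\<bar> powr (- \<beta>)" by (simp add: sum_distrib_right mult.assoc)
  finally show "mixture f x \<theta> \<le> ?C * \<bar>x\<bar> powr (- \<beta>)" .
qed

text \<open>The exponent is chosen such that \<open>X n\<close> leaves the \<open>n\<close>-th interval with probability of order
  \<open>n powr (- 2)\<close>, which is summable. As the intervals increase to the whole line, they eventually
  contain also the finitely many earlier observations that left their own interval.\<close>

lemma AE_sample_in_interval:
  fixes X :: "nat \<Rightarrow> 'w \<Rightarrow> real"
  assumes P: "prob_space P"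
    and distr: "\<And>i. i \<ge> 1 \<Longrightarrow> distributed P lborel (X i) (\<lambda>x. ennreal (q x))"
    and tail: "\<And>x. r \<le> \<bar>x\<bar> \<Longrightarrow> q x \<le> C * \<bar>x\<bar> powr (- \<beta>)" and C: "0 \<le> C" and \<beta>: "\<beta> > 1"
  shows "AE \<omega> in P. \<forall>\<^sub>F n in sequentially. \<forall>i\<in>{1..n}.
    X i \<omega> \<in> {- (real n powr (2 / (\<beta> - 1)))..real n powr (2 / (\<beta> - 1))}"
proof -
  interpret prob_space P by (rule P)
  define R where "R n = real n powr (2 / (\<beta> - 1))" for n :: nat
  have a: "2 / (\<beta> - 1) > 0" using \<beta> by simp
  have R_lim: "filterlim R at_top sequentially" unfolding R_def using a
    by (intro filterlim_compose[OF real_powr_at_top filterlim_real_sequentially])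
  have R_mono: "R i \<le> R n" if "i \<le> n" for i n
    unfolding R_def using that a by (intro powr_mono2) auto
  have R_pos: "R (Suc n) > 0" for n by (simp add: R_def)
  have X [measurable]: "X (Suc i) \<in> borel_measurable P" for i
    using distributed_measurable[OF distr[of "Suc i"]] by simp
  define E where "E n = X (Suc n) -` {x. R (Suc n) < \<bar>x\<bar>} \<inter> space P" for n
  have E_meas: "E n \<in> sets P" for n unfolding E_def by measurable
  have "AE \<omega> in P. \<forall>\<^sub>F n in sequentially. \<omega> \<in> space P - E n"
  proof (rule borel_cantelli_AE1[OF E_meas])
    show "emeasure P (E n) < \<infinity>" for n by (simp add: less_top[symmetric])
    have "\<forall>\<^sub>F n in sequentially. r \<le> R (Suc n)"
      using R_lim unfolding filterlim_at_top
      by (subst eventually_sequentially_Suc) auto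
    then have "\<forall>\<^sub>F n in sequentially. norm (measure P (E n)) \<le> 2 * C / (\<beta> - 1) * real (Suc n) powr (- 2)"
    proof eventually_elim
      case (elim n)
      have "emeasure P (E n) = (\<integral>\<^sup>+x. ennreal (q x) * indicator {x. R (Suc n) < \<bar>x\<bar>} x \<partial>lborel)"
        unfolding E_def by (intro distributed_emeasure distr) auto
      also have "\<dots> \<le> (\<integral>\<^sup>+x. ennreal C * ennreal (indicator {x. R (Suc n) < \<bar>x\<bar>} x * \<bar>x\<bar> powr (- \<beta>)) \<partial>lborel)"
        using tail elim C
        by (intro nn_integral_mono) (auto simp: indicator_def ennreal_mult[symmetric] intro!: ennreal_leI)
      also have "\<dots> = ennreal C * (\<integral>\<^sup>+x. ennreal (indicator {x. R (Suc n) < \<bar>x\<bar>} x * \<bar>x\<bar> powr (- \<beta>)) \<partial>lborel)"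
        by (intro nn_integral_cmult) measurable
      also have "\<dots> \<le> ennreal C * ennreal (2 * R (Suc n) powr (1 - \<beta>) / (\<beta> - 1))"
        by (intro mult_left_mono nn_integral_powr_tail \<beta> R_pos) auto
      also have "\<dots> = ennreal (C * (2 * R (Suc n) powr (1 - \<beta>) / (\<beta> - 1)))"
        using C \<beta> by (intro ennreal_mult[symmetric]) auto
      also have "R (Suc n) powr (1 - \<beta>) = real (Suc n) powr (- 2)"
      proof -
        have "2 / (\<beta> - 1) * (1 - \<beta>) = - 2" using \<beta> by (simp add: field_simps)
        then show ?thesis unfolding R_def powr_powr by simp
      qed
      finally have "emeasure P (E n) \<le> ennreal (C * (2 * real (Suc n) powr (- 2) / (\<beta> - 1)))" .
      then show ?case using C \<beta> by (simp add: emeasure_eq_measure mult_ac)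
    qed
    moreover have "summable (\<lambda>n. 2 * C / (\<beta> - 1) * real (Suc n) powr (- 2))"
      by (subst summable_Suc_iff[where f = "\<lambda>n. 2 * C / (\<beta> - 1) * real n powr (- 2)"])
         (intro summable_mult, simp add: summable_real_powr_iff)
    ultimately show "summable (\<lambda>n. measure P (E n))" by (rule summable_comparison_test_ev)
  qed
  then show ?thesis
  proof (rule AE_mp, intro AE_I2 impI)
    fix \<omega> assume "\<omega> \<in> space P" and "\<forall>\<^sub>F n in sequentially. \<omega> \<in> space P - E n"
    then obtain n0 where n0: "\<And>n. n \<ge> n0 \<Longrightarrow> \<bar>X (Suc n) \<omega>\<bar> \<le> R (Suc n)"
      unfolding eventually_sequentially E_def by (auto simp: not_less)
    have "\<forall>\<^sub>F n in sequentially. \<forall>i\<in>{..n0}. \<bar>X i \<omega>\<bar> \<le> R n"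
      using R_lim unfolding filterlim_at_top by (intro eventually_ball_finite) auto
    then show "\<forall>\<^sub>F n in sequentially. \<forall>i\<in>{1..n}. X i \<omega> \<in> {- (real n powr (2 / (\<beta> - 1)))..real n powr (2 / (\<beta> - 1))}"
    proof eventually_elim
      case (elim n)
      show ?case
      proof
        fix i assume i: "i \<in> {1..n}"
        have "\<bar>X i \<omega>\<bar> \<le> R n"
        proof (cases "i \<le> n0")
          case True
          then show ?thesis using elim by blast
        next
          case False
          then have "\<bar>X i \<omega>\<bar> \<le> R i" using n0[of "i - 1"] by simp
          also have "\<dots> \<le> R n" using i by (intro R_mono) auto
          finally show ?thesis .
        qed
        then show "X i \<omega> \<in> {- (real n powr (2 / (\<beta> - 1)))..real n powr (2 / (\<beta> - 1))}"
          by (auto simp: R_def abs_le_iff)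
      qed
    qed
  qed
qed

lemma subexponential_powr:
  assumes "a > 0"
  shows "subexponential (\<lambda>n. real n powr a)"
  unfolding subexponential_def
proof (intro allI impI)
  fix \<kappa> :: real assume "\<kappa> > 0"
  then show "\<forall>\<^sub>F n in sequentially. real n powr a \<le> exp (\<kappa> * real n)"
    using assms by real_asymp
qed

lemma subexponential_exp_powr:
  assumes "0 < d" "d < 1"
  shows "subexponential (\<lambda>n. exp (real n powr d))"
  unfolding subexponential_def
proof (intro allI impI)
  fix \<kappa> :: real assume \<kappa>: "\<kappa> > 0"
  have "((\<lambda>n. real n powr (d - 1)) \<longlongrightarrow> 0) sequentially"
    using assms by real_asymp
  then have "\<forall>\<^sub>F n in sequentially. real n powr (d - 1) < \<kappa>"
    using \<kappa> by (intro order_tendstoD)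
  then show "\<forall>\<^sub>F n in sequentially. exp (real n powr d) \<le> exp (\<kappa> * real n)"
    using eventually_gt_at_top[of 0]
  proof eventually_elim
    case (elim n)
    have "real n powr d = real n powr (d - 1) * real n"
      using elim by (simp add: powr_diff)
    also have "\<dots> \<le> \<kappa> * real n" using elim by (intro mult_right_mono) auto
    finally show ?case by simp
  qed
qed

theorem corollary1:
  fixes f :: "('m::finite) families"
    and \<theta>\<^sub>0 :: "'m param"
    and P :: "'w measure"
    and X :: "nat \<Rightarrow> 'w \<Rightarrow> real"
    and v0 v1 \<beta> c\<^sub>0 d :: real
    and \<theta>hat :: "nat \<Rightarrow> 'w \<Rightarrow> 'm param"
  assumes families: "\<And>m. location_scale_family (f m)"
    and true_param: "\<theta>\<^sub>0 \<in> Theta"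
    and prob: "prob_space P"
    and indep: "prob_space.indep_vars P (\<lambda>_. borel) X {1..}"
    and distr: "\<And>i. i \<ge> 1 \<Longrightarrow> distributed P lborel (X i) (\<lambda>x. ennreal (mixture f x \<theta>\<^sub>0))"
    and constants: "v0 > 0" "v1 > 0" "\<beta> > 1"
    and bound_const: "\<And>m x. f m x 0 1 \<le> v0"
    \<comment> \<open>the bound \<open>v1 |x|\<^sup>-\<^sup>\<beta>\<close> is infinite at \<open>x = 0\<close>, whereas \<open>0 powr (- \<beta>) = 0\<close>\<close>
    and bound_tail: "\<And>m x. x \<noteq> 0 \<Longrightarrow> f m x 0 1 \<le> v1 * \<bar>x\<bar> powr (- \<beta>)"
    and sup_measurable:
      "\<And>\<Gamma> \<theta>. compact \<Gamma> \<Longrightarrow> \<Gamma> \<subseteq> Theta \<Longrightarrow> \<theta> \<in> \<Gamma> \<Longrightarrow>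
         \<forall>\<^sub>F \<rho> in at_right 0. (\<lambda>x. mixture_sup f x \<theta> \<rho>) \<in> borel_measurable lebesgue"
    and param_continuous:
      "\<And>\<Gamma> \<theta>. compact \<Gamma> \<Longrightarrow> \<Gamma> \<subseteq> Theta \<Longrightarrow> \<theta> \<in> \<Gamma> \<Longrightarrow>
         AE x in lborel. \<forall>\<theta>s :: nat \<Rightarrow> 'm param. (\<forall>j. \<theta>s j \<in> \<Gamma>) \<longrightarrow> \<theta>s \<longlonglongrightarrow> \<theta> \<longrightarrow>
           (\<lambda>j. mixture f x (\<theta>s j)) \<longlonglongrightarrow> mixture f x \<theta>"
    and log_integrable:
      "integrable lborel (\<lambda>x. \<bar>ln (mixture f x \<theta>\<^sub>0)\<bar> * mixture f x \<theta>\<^sub>0)"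
    and exact_order:
      "(\<lambda>x. mixture f x \<theta>\<^sub>0) \<in> G_upto f (CARD('m)) - G_upto f (CARD('m) - 1)"
    and rate: "c\<^sub>0 > 0" "0 < d" "d < 1"
    and mle:
      "\<And>n. n \<ge> 1 \<Longrightarrow> AE \<omega> in P.
         is_restricted_mle f (Theta_ge (c\<^sub>0 * exp (- (real n powr d)))) n (\<lambda>i. X i \<omega>) (\<theta>hat n \<omega>)"
  shows "AE \<omega> in P. (\<lambda>n. L1_norm (\<lambda>x. mixture f x (\<theta>hat n \<omega>) - mixture f x \<theta>\<^sub>0)) \<longlonglongrightarrow> 0"
proof -
  define c where "c n = c\<^sub>0 * exp (- (real n powr d))" for n :: nat
  define R where "R n = real n powr (2 / (\<beta> - 1))" for n :: nat
  define F where "F n = {(\<lambda>x. mixture f x \<theta>) | \<theta>. \<theta> \<in> Theta_ge (c n)}" for n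
  have c_pos: "c n > 0" for n using rate by (simp add: c_def)
  have a: "2 / (\<beta> - 1) > 0" using constants by simp
  have F_density: "probability_density p" if "p \<in> F n" for p n
    using that probability_density_mixture[OF families] by (auto simp: F_def Theta_ge_def)
  obtain C r where C: "0 \<le> C" and tail: "\<And>x. r \<le> \<bar>x\<bar> \<Longrightarrow> mixture f x \<theta>\<^sub>0 \<le> C * \<bar>x\<bar> powr (- \<beta>)"
    using mixture_tail[of f \<theta>\<^sub>0 v1 \<beta>] families true_param constants bound_tail by blast
  have inD: "AE \<omega> in P. \<forall>\<^sub>F n in sequentially. \<forall>i\<in>{1..n}. X i \<omega> \<in> {- R n..R n}"
    unfolding R_def by (rule AE_sample_in_interval[OF prob distr tail C constants(3)])
  have "subexponential (\<lambda>n. 1 / c\<^sub>0 * exp (real n powr d))"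
    using rate by (intro subexponential_mult subexponential_const subexponential_exp_powr) auto
  then have c_sub: "subexponential (\<lambda>n. 1 / c n)"
    by (simp add: c_def exp_minus field_simps)
  have R_lim: "filterlim R at_top sequentially" unfolding R_def using a
    by (intro filterlim_compose[OF real_powr_at_top filterlim_real_sequentially])
  have R_nonneg: "0 \<le> R n" for n by (simp add: R_def)
  have R_sub: "subexponential R" unfolding R_def by (rule subexponential_powr[OF a])
  have comp: "subexp_bracketed (\<lambda>n. {- R n..R n})
      (\<lambda>n. {(\<lambda>x. \<alpha> * f m x \<mu> \<sigma>) | \<alpha> \<mu> \<sigma>. 0 \<le> \<alpha> \<and> \<alpha> \<le> 1 \<and> c n \<le> \<sigma>})" for m
  proof (rule component_bracketed[OF families constants])
    show "\<exists>\<rho> g. 0 < \<rho> \<and> integrable lborel g \<and> (\<integral>x. g x \<partial>lborel) \<le> 1 + \<epsilon> \<and>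
        (\<forall>x \<mu> \<sigma>. \<bar>\<mu>\<bar> \<le> \<rho> \<longrightarrow> \<bar>\<sigma> - 1\<bar> \<le> \<rho> \<longrightarrow> f m x \<mu> \<sigma> \<le> g x)" if "\<epsilon> > 0" for \<epsilon>
    proof (rule local_majorant[OF families constants])
      show "\<And>m x. x \<noteq> 0 \<Longrightarrow> f m x 0 1 \<le> v1 * \<bar>x\<bar> powr (- \<beta>)" by (rule bound_tail)
    qed (fact bound_const sup_measurable param_continuous that)+
  qed (fact bound_const bound_tail c_pos c_sub R_nonneg R_lim R_sub)+
  have br: "subexp_bracketed (\<lambda>n. {- R n..R n}) F"
  proof (rule subexp_bracketed_mono[OF subexp_bracketed_sum[OF comp]])
    fix m n p assume "p \<in> {(\<lambda>x. \<alpha> * f m x \<mu> \<sigma>) | \<alpha> \<mu> \<sigma>. 0 \<le> \<alpha> \<and> \<alpha> \<le> 1 \<and> c n \<le> \<sigma>}"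
    then obtain \<alpha> \<mu> \<sigma> where p: "p = (\<lambda>x. \<alpha> * f m x \<mu> \<sigma>)" and "c n \<le> \<sigma>" by blast
    then have "\<sigma> > 0" using c_pos[of n] by linarith
    then show "integrable lborel p" unfolding p
      by (intro integrable_mult_right probability_density_integral location_scale_family_density families)
  next
    fix n
    show "F n \<subseteq> {(\<lambda>x. \<Sum>m\<in>UNIV. p m x) | p. \<forall>m. p m \<in>
        {(\<lambda>x. \<alpha> * f m x \<mu> \<sigma>) | \<alpha> \<mu> \<sigma>. 0 \<le> \<alpha> \<and> \<alpha> \<le> 1 \<and> c n \<le> \<sigma>}}"
    proof
      fix q assume "q \<in> F n"
      then obtain \<theta> where q: "q = (\<lambda>x. mixture f x \<theta>)" and \<theta>: "\<theta> \<in> Theta" "\<And>m. c n \<le> scale (\<theta> $ m)"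
        by (auto simp: F_def Theta_ge_def)
      have w0: "0 \<le> weight (\<theta> $ m)" for m using \<theta> by (simp add: Theta_def)
      have "weight (\<theta> $ m) \<le> (\<Sum>m\<in>UNIV. weight (\<theta> $ m))" for m
        using w0 by (intro member_le_sum) auto
      then have w1: "weight (\<theta> $ m) \<le> 1" for m using \<theta>(1) by (simp add: Theta_def)
      show "q \<in> {(\<lambda>x. \<Sum>m\<in>UNIV. p m x) | p. \<forall>m. p m \<in>
          {(\<lambda>x. \<alpha> * f m x \<mu> \<sigma>) | \<alpha> \<mu> \<sigma>. 0 \<le> \<alpha> \<and> \<alpha> \<le> 1 \<and> c n \<le> \<sigma>}}"
        unfolding q mixture_def
        by (intro CollectI exI[of _ "\<lambda>m x. weight (\<theta> $ m) * f m x (loc (\<theta> $ m)) (scale (\<theta> $ m))"])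
           (use w0 w1 \<theta>(2) in blast)
    qed
  qed auto
  have \<theta>0_in: "\<forall>\<^sub>F n in sequentially. \<theta>\<^sub>0 \<in> Theta_ge (c n)"
  proof -
    have "c \<longlonglongrightarrow> 0" unfolding c_def using rate by real_asymp
    then have "\<forall>\<^sub>F n in sequentially. c n < scale (\<theta>\<^sub>0 $ m)" for m
      using true_param by (intro order_tendstoD) (auto simp: Theta_def)
    then have "\<forall>\<^sub>F n in sequentially. \<forall>m. c n < scale (\<theta>\<^sub>0 $ m)"
      by (intro eventually_all_finite)
    then show ?thesis
      by (rule eventually_mono) (use true_param in \<open>auto simp: Theta_ge_def less_imp_le\<close>)
  qed
  have mle_all: "AE \<omega> in P. \<forall>n\<in>{1..}. is_restricted_mle f (Theta_ge (c n)) n (\<lambda>i. X i \<omega>) (\<theta>hat n \<omega>)"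
    using mle by (subst AE_ball_countable) (auto simp: c_def)
  have "AE \<omega> in P. \<forall>p. (\<forall>\<^sub>F n in sequentially. p n \<in> F n \<and>
       (\<Prod>i=1..n. mixture f (X i \<omega>) \<theta>\<^sub>0) \<le> (\<Prod>i=1..n. p n (X i \<omega>))) \<longrightarrow>
     (\<lambda>n. L1_norm (\<lambda>x. p n x - mixture f x \<theta>\<^sub>0)) \<longlonglongrightarrow> 0"
    by (rule sieve_mle_consistent[OF prob indep distr probability_density_mixture[OF families true_param]
          _ inD F_density br]) auto
  with mle_all show ?thesis
  proof eventually_elim
    case (elim \<omega>)
    have "\<forall>\<^sub>F n in sequentially. (\<lambda>x. mixture f x (\<theta>hat n \<omega>)) \<in> F n \<and>
       (\<Prod>i=1..n. mixture f (X i \<omega>) \<theta>\<^sub>0) \<le> (\<Prod>i=1..n. mixture f (X i \<omega>) (\<theta>hat n \<omega>))"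
      using \<theta>0_in eventually_ge_at_top[of 1]
    proof eventually_elim
      case (elim n)
      then have "is_arg_max (likelihood f n (\<lambda>i. X i \<omega>)) (\<lambda>\<theta>. \<theta> \<in> Theta_ge (c n)) (\<theta>hat n \<omega>)"
        using \<open>\<forall>n\<in>{1..}. _ n\<close> by (simp add: is_restricted_mle_def)
      then have "\<theta>hat n \<omega> \<in> Theta_ge (c n)"
        "likelihood f n (\<lambda>i. X i \<omega>) \<theta>\<^sub>0 \<le> likelihood f n (\<lambda>i. X i \<omega>) (\<theta>hat n \<omega>)"
        using elim(1) by (auto simp: is_arg_max_linorder)
      then show ?case by (auto simp: F_def likelihood_def)
    qed
    then show ?case
      using elim(2)[rule_format, of "\<lambda>n x. mixture f x (\<theta>hat n \<omega>)"] by blast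
  qed
qed

end
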